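(* Let $\Omega\subset\mathbb{R}^N$ ($N\ge 1$) be a bounded open set with a Lipschitz continuous boundary and satisfying the exterior ball condition, let $0<s<1$, $T>0$, $Q:=(0,T)\times\Omega$, and let $2\le p<\infty$, $2\le r<\infty$ satisfy $1>\frac{N}{2ps}+\frac1r$. Let $Z:=L^r((0,T);L^p(\Omega))$, let $Z_{ad}\subset Z$ be nonempty, closed and convex, let $u_d\in L^2(Q)$, $\alpha>0$, $\gamma>0$, $0\le\hat\mu\in L^2(Q)$, and set $$J(u,z):=\tfrac12\|u-u_d\|^2_{L^2(Q)}+\tfrac\alpha2\|z\|^2_{L^2(Q)},\qquad J^\gamma(u,z):=J(u,z)+\tfrac1{2\gamma}\|(\hat\mu+\gamma u)_+\|^2_{L^2(Q)} .$$ Let $(\bar u,\bar z)$ denote the solution of the state-constrained problem (with upper bound $u_b\equiv0$) $$\min_{(u,z)\in U\times Z} J(u,z)\ \text{ s.t. }\ \partial_tu+(-\Delta)^s_Du=z\text{ in }Q,\ u(0,\cdot)=0\text{ in }\Omega,\ u\le0\text{ in }\overline Q,\ z\in Z_{ad},$$ with associated Lagrange multiplier $\bar\mu\in\mathcal{M}(\overline Q)$ (as described in the context), and let $(\bar u^\gamma,\bar z^\gamma)$ denote the solution of the regularized problem $$\min_{(u,z)\in U\times Z} J^\gamma(u,z)\ \text{ s.t. }\ \partial_tu+(-\Delta)^s_Du=z\text{ in }Q,\ u(0,\cdot)=0\text{ in }\Omega,\ z\in Z_{ad}.$$ Then $$\alpha\|\bar z-\bar z^\gamma\|^2_{L^2(Q)}+\|\bar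 u-\bar u^\gamma\|^2_{L^2(Q)}+\gamma\|(\bar u^\gamma)_+\|^2_{L^2(Q)}\le\frac1\gamma\|\hat\mu\|^2_{L^2(Q)}+\langle\bar\mu,\bar u^\gamma\rangle_{\mathcal{M}(\overline Q),C(\overline Q)},$$ and hence $$\|(\bar u^\gamma)_+\|_{L^2(Q)}\le\sqrt{\frac2\gamma}\,\max\left(\frac1\gamma\|\hat\mu\|^2_{L^2(Q)},\ \langle\bar\mu,(\bar u^\gamma)_+\rangle_{\mathcal{M}(\overline Q),C(\overline Q)}\right)^{\frac12}.$$
   Context: $(\cdot)_+:=\max\{0,\cdot\}$. $\mathcal{M}(\overline Q)=(C(\overline Q))^\star$ is the space of (signed) Radon measures on $\overline Q$, with pairing $\langle\mu,v\rangle_{\mathcal{M}(\overline Q),C(\overline Q)}=\int_{\overline Q}v\,d\mu$. $\widetilde W^{s,2}_0(\Omega):=\{u\in W^{s,2}(\mathbb{R}^N): u=0 \text{ in }\mathbb{R}^N\setminus\Omega\}$, where $W^{s,2}(\mathbb{R}^N)$ is the space of $u\in L^2(\mathbb{R}^N)$ with $\int_{\mathbb{R}^N}\int_{\mathbb{R}^N}\frac{|u(x)-u(y)|^2}{|x-y|^{N+2s}}\,dx\,dy<\infty$; $\widetilde W^{-s,2}(\Omega)$ is its dual with respect to the pivot space $L^2(\Omega)$; $\mathbb{U}_0:=L^2((0,T);\widetilde W^{s,2}_0(\Omega))\cap H^1((0,T);\widetilde W^{-s,2}(\Omega))$. $(-\Delta)^su(x)=C_{N,s}\,\mathrm{P.V.}\int_{\mathbb{R}^N}\frac{u(x)-u(y)}{|x-y|^{N+2s}}\,dy$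 with $C_{N,s}=\frac{s2^{2s}\Gamma(\frac{2s+N}{2})}{\pi^{N/2}\Gamma(1-s)}$. $(-\Delta)^s_D$ is its realization in $L^2(\Omega)$ with zero exterior condition, also viewed as a bounded operator $\widetilde W^{s,2}_0(\Omega)\to\widetilde W^{-s,2}(\Omega)$ via $\langle(-\Delta)^s_Du,v\rangle=\mathcal{E}(u,v):=\frac{C_{N,s}}2\int_{\mathbb{R}^N}\int_{\mathbb{R}^N}\frac{(u(x)-u(y))(v(x)-v(y))}{|x-y|^{N+2s}}\,dx\,dy$. $U:=\{u\in\mathbb{U}_0\cap C(\overline Q):(\partial_t+(-\Delta)^s_D)(u|_\Omega)\in L^r((0,T);L^p(\Omega))\}$. State equations are understood in the weak sense: $u\in\mathbb{U}_0$, $u(0,\cdot)=0$ a.e. in $\Omega$, and $\langle\partial_tu,v\rangle+\mathcal{E}(u,v)=\langle z,v\rangle$ for every $v\in\widetilde W^{s,2}_0(\Omega)$ and a.e. $t\in(0,T)$. Lagrange multiplier $\bar\mu$: $\bar\mu\in\mathcal{M}(\overline Q)$ together with an adjoint state $\bar\xi\in(L^r((0,T);L^p(\Omega)))^\star$ satisfies the first order optimality system of the state-constrained problem, namely, with $\bar\mu_Q:=\bar\mu|_Q$, $\bar\mu_T:=\bar\mu|_{\{T\}\times\overline\Omega}$: (i) $-\partial_t\bar\xi+(-\Delta)^s_D\bar\xi=\bar u-u_d+\bar\mu_Q$ in $Q$, $\bar\xi(T,\cdot)=\bar\mu_T$ in $\overline\Omega$, in the very-weak sense, i.e. the measure $\bar\mu$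 has zero restrictions to $\{0\}\times\overline\Omega$ and to $(0,T)\times\partial\Omega$ and $\int_Q\bar\xi(\partial_tv+(-\Delta)^sv)\,dx\,dt=\int_Q(\bar u-u_d)v\,dx\,dt+\int_Qv\,d\bar\mu_Q+\int_{\overline\Omega}v(T,x)\,d\bar\mu_T(x)$ for every $v\in C(\overline Q)\cap\mathbb{U}_0$ with $v(0,\cdot)=0$ a.e. in $\Omega$ and $(\partial_t+(-\Delta)^s)v\in L^r((0,T);L^p(\Omega))$; (ii) $\langle\bar\xi+\alpha\bar z,z-\bar z\rangle_{(L^r((0,T);L^p(\Omega)))^\star,L^r((0,T);L^p(\Omega))}\ge0$ for all $z\in Z_{ad}$; (iii) $\bar\mu\ge0$, $\bar u\le0$ in $\overline Q$, and $\int_{\overline Q}\bar u\,d\bar\mu=0$. *)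

theory Defs
  imports "HOL-Analysis.Analysis"
begin

section \<open>Lebesgue and Bochner spaces, dual spaces\<close>

text \<open>
  The library has no types for the function spaces involved, so a space is given by a set of
  functions (representatives) together with a seminorm, and elements are
  identified when their difference has seminorm zero.
\<close>

definition lp_space :: "real \<Rightarrow> 'c measure \<Rightarrow> ('c \<Rightarrow> real) set" where
  "lp_space p M = {f \<in> borel_measurable M. integrable M (\<lambda>x. \<bar>f x\<bar> powr p)}"

definition lp_norm :: "real \<Rightarrow> 'c measure \<Rightarrow> ('c \<Rightarrow> real) \<Rightarrow> real" where
  "lp_norm p M f = (LINT x|M. \<bar>f x\<bar> powr p) powr (1 / p)"

text \<open>
  The Bochner space $L^q((0,T);X)$ for a space $X$ of real functions with seminorm \<open>nrm\<close>:
  strongly measurable functions, i.e. a.e. limits of simple functions, whose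
  \<open>q\<close>-th power of the norm is integrable. The type \<open>'c\<close> is the domain of the elements of $X$;
  it is the space $R^N$ for Lebesgue and Sobolev spaces, and a type of functions if $X$ is itself
  a dual space.
\<close>

definition bochner_space ::
  "real \<Rightarrow> real \<Rightarrow> ('c \<Rightarrow> real) set \<Rightarrow> (('c \<Rightarrow> real) \<Rightarrow> real) \<Rightarrow> (real \<Rightarrow> 'c \<Rightarrow> real) set" where
  "bochner_space q T X nrm = {w.
     (\<exists>S :: nat \<Rightarrow> real \<Rightarrow> 'c \<Rightarrow> real.
        (\<forall>n. simple_function (lebesgue_on {0<..<T}) (S n) \<and> S n ` {0<..<T} \<subseteq> X) \<and>
        (AE t in lebesgue_on {0<..<T}. (\<lambda>n. nrm (\<lambda>c. S n t c - w t c)) \<longlonglongrightarrow> 0)) \<and>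
     (AE t in lebesgue_on {0<..<T}. w t \<in> X) \<and>
     integrable (lebesgue_on {0<..<T}) (\<lambda>t. nrm (w t) powr q)}"

definition bochner_norm ::
  "real \<Rightarrow> real \<Rightarrow> (('c \<Rightarrow> real) \<Rightarrow> real) \<Rightarrow> (real \<Rightarrow> 'c \<Rightarrow> real) \<Rightarrow> real" where
  "bochner_norm q T nrm w = (LINT t|lebesgue_on {0<..<T}. nrm (w t) powr q) powr (1 / q)"

definition dual_space ::
  "('c \<Rightarrow> real) set \<Rightarrow> (('c \<Rightarrow> real) \<Rightarrow> real) \<Rightarrow> (('c \<Rightarrow> real) \<Rightarrow> real) set" where
  "dual_space X nrm = {w.
     (\<forall>f\<in>X. \<forall>g\<in>X. \<forall>a b. w (\<lambda>c. a * f c + b * g c) = a * w f + b * w g) \<and>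
     (\<exists>C. \<forall>f\<in>X. \<bar>w f\<bar> \<le> C * nrm f)}"

definition dual_norm ::
  "('c \<Rightarrow> real) set \<Rightarrow> (('c \<Rightarrow> real) \<Rightarrow> real) \<Rightarrow> (('c \<Rightarrow> real) \<Rightarrow> real) \<Rightarrow> real" where
  "dual_norm X nrm w = Sup {\<bar>w f\<bar> | f. f \<in> X \<and> nrm f \<le> 1}"


section \<open>Assumptions on the domain\<close>

text \<open>
  Near each boundary point the set is, in a suitable orthogonal frame, the region strictly above
  the graph of a Lipschitz function; \<open>x - (x \<bullet> e) *\<^sub>R e\<close> is the orthogonal projection of \<open>x\<close>
  onto the hyperplane with unit normal \<open>e\<close>.
\<close>

definition lipschitz_boundary :: "'a::euclidean_space set \<Rightarrow> bool" where
  "lipschitz_boundary \<Omega> \<longleftrightarrow>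
     (\<forall>x0\<in>frontier \<Omega>. \<exists>V e g L. open V \<and> x0 \<in> V \<and> norm e = 1 \<and>
        L-lipschitz_on {y. y \<bullet> e = 0} (g :: 'a \<Rightarrow> real) \<and>
        \<Omega> \<inter> V = {x \<in> V. g (x - (x \<bullet> e) *\<^sub>R e) < x \<bullet> e})"

text \<open>
  The radius may depend on the boundary point, so that the condition is implied by the uniform
  version as well.
\<close>

definition exterior_ball_condition :: "'a::euclidean_space set \<Rightarrow> bool" where
  "exterior_ball_condition \<Omega> \<longleftrightarrow>
     (\<forall>x0\<in>frontier \<Omega>. \<exists>y \<rho>. 0 < \<rho> \<and> ball y \<rho> \<inter> \<Omega> = {} \<and> dist x0 y = \<rho>)"


section \<open>Fractional Sobolev spaces and the fractional Laplacian\<close>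

text \<open>
  The double integrals are integrals over the product space. On the diagonal, a null set, the
  quotients below are zero by convention.
\<close>

definition sobolev :: "real \<Rightarrow> ('a::euclidean_space \<Rightarrow> real) set" where
  "sobolev s = {u \<in> lp_space 2 lebesgue.
     integrable (lebesgue :: ('a \<times> 'a) measure)
       (\<lambda>(x, y). \<bar>u x - u y\<bar>\<^sup>2 / norm (x - y) powr (real DIM('a) + 2 * s))}"

definition sobolev_norm :: "real \<Rightarrow> ('a::euclidean_space \<Rightarrow> real) \<Rightarrow> real" where
  "sobolev_norm s u = sqrt ((LINT x|lebesgue. \<bar>u x\<bar>\<^sup>2) +
     integral\<^sup>L (lebesgue :: ('a \<times> 'a) measure)
       (\<lambda>(x, y). \<bar>u x - u y\<bar>\<^sup>2 / norm (x - y) powr (real DIM('a) + 2 * s)))"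

definition sobolev0 :: "real \<Rightarrow> 'a::euclidean_space set \<Rightarrow> ('a \<Rightarrow> real) set" where
  "sobolev0 s \<Omega> = {u \<in> sobolev s. AE x in lebesgue. x \<notin> \<Omega> \<longrightarrow> u x = 0}"

definition sobolev_dual ::
  "real \<Rightarrow> 'a::euclidean_space set \<Rightarrow> (('a \<Rightarrow> real) \<Rightarrow> real) set" where
  "sobolev_dual s \<Omega> = dual_space (sobolev0 s \<Omega>) (sobolev_norm s)"

definition frac_const :: "nat \<Rightarrow> real \<Rightarrow> real" where
  "frac_const N s = s * 2 powr (2 * s) * Gamma ((2 * s + real N) / 2) /
     (pi powr (real N / 2) * Gamma (1 - s))"

definition energy ::
  "real \<Rightarrow> ('a::euclidean_space \<Rightarrow> real) \<Rightarrow> ('a \<Rightarrow> real) \<Rightarrow> real" where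
  "energy s u v = frac_const DIM('a) s / 2 *
     integral\<^sup>L (lebesgue :: ('a \<times> 'a) measure)
       (\<lambda>(x, y). (u x - u y) * (v x - v y) / norm (x - y) powr (real DIM('a) + 2 * s))"

text \<open>The embedding of $L^2(\Omega)$, as pivot space, into the dual space.\<close>

definition pivot :: "'a::euclidean_space set \<Rightarrow> ('a \<Rightarrow> real) \<Rightarrow> ('a \<Rightarrow> real) \<Rightarrow> real" where
  "pivot \<Omega> f v = (LINT x|lebesgue_on \<Omega>. f x * v x)"


section \<open>Parabolic spaces and the state equation\<close>

definition cylinder :: "real \<Rightarrow> 'a set \<Rightarrow> (real \<times> 'a) set" where
  "cylinder T \<Omega> = {0<..<T} \<times> \<Omega>"

definition test_functions :: "real \<Rightarrow> (real \<Rightarrow> real) set" where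
  "test_functions T = {\<phi>. (\<forall>k t. (deriv ^^ k) \<phi> field_differentiable at t) \<and>
     (\<exists>K. compact K \<and> K \<subseteq> {0<..<T} \<and> (\<forall>t. t \<notin> K \<longrightarrow> \<phi> t = 0))}"

definition L2_dual ::
  "real \<Rightarrow> real \<Rightarrow> 'a::euclidean_space set \<Rightarrow> (real \<Rightarrow> ('a \<Rightarrow> real) \<Rightarrow> real) set" where
  "L2_dual s T \<Omega> =
     bochner_space 2 T (sobolev_dual s \<Omega>) (dual_norm (sobolev0 s \<Omega>) (sobolev_norm s))"

text \<open>
  The vector-valued identity $\int \phi' w\,dt = -\int \phi w'\,dt$ in the dual space, evaluated
  at the elements of the predual.
\<close>

definition weak_time_derivative :: "real \<Rightarrow> real \<Rightarrow> 'a::euclidean_space set \<Rightarrow>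
    (real \<Rightarrow> ('a \<Rightarrow> real) \<Rightarrow> real) \<Rightarrow> (real \<Rightarrow> ('a \<Rightarrow> real) \<Rightarrow> real) \<Rightarrow> bool" where
  "weak_time_derivative s T \<Omega> w w' \<longleftrightarrow>
     (\<forall>\<phi>\<in>test_functions T. \<forall>v\<in>sobolev0 s \<Omega>.
        (LINT t|lebesgue_on {0<..<T}. deriv \<phi> t * w t v) =
        - (LINT t|lebesgue_on {0<..<T}. \<phi> t * w' t v))"

definition H1_dual ::
  "real \<Rightarrow> real \<Rightarrow> 'a::euclidean_space set \<Rightarrow> (real \<Rightarrow> ('a \<Rightarrow> real) \<Rightarrow> real) set" where
  "H1_dual s T \<Omega> =
     {w \<in> L2_dual s T \<Omega>. \<exists>w'\<in>L2_dual s T \<Omega>. weak_time_derivative s T \<Omega> w w'}"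

definition U0_space ::
  "real \<Rightarrow> real \<Rightarrow> 'a::euclidean_space set \<Rightarrow> (real \<times> 'a \<Rightarrow> real) set" where
  "U0_space s T \<Omega> = {u.
     curry u \<in> bochner_space 2 T (sobolev0 s \<Omega>) (sobolev_norm s) \<and>
     (\<lambda>t. pivot \<Omega> (curry u t)) \<in> H1_dual s T \<Omega>}"

text \<open>
  $L^r((0,T);L^p(\Omega))$. Representatives are taken to be jointly measurable, so that they can be
  integrated over the cylinder.
\<close>

definition LrLp :: "real \<Rightarrow> real \<Rightarrow> real \<Rightarrow> 'a::euclidean_space set \<Rightarrow> (real \<times> 'a \<Rightarrow> real) set" where
  "LrLp r p T \<Omega> = {z \<in> borel_measurable (lebesgue_on (cylinder T \<Omega>)).
     curry z \<in> bochner_space r T (lp_space p (lebesgue_on \<Omega>)) (lp_norm p (lebesgue_on \<Omega>))}"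

definition LrLp_norm ::
  "real \<Rightarrow> real \<Rightarrow> real \<Rightarrow> 'a::euclidean_space set \<Rightarrow> (real \<times> 'a \<Rightarrow> real) \<Rightarrow> real" where
  "LrLp_norm r p T \<Omega> z = bochner_norm r T (lp_norm p (lebesgue_on \<Omega>)) (curry z)"

text \<open>
  The equation $(\partial_t + (-\Delta)^s_D) u = f$, with $f(t) \in L^2(\Omega)$ acting on test
  functions through the pivot space.
\<close>

definition parabolic_eq :: "real \<Rightarrow> real \<Rightarrow> 'a::euclidean_space set \<Rightarrow>
    (real \<times> 'a \<Rightarrow> real) \<Rightarrow> (real \<times> 'a \<Rightarrow> real) \<Rightarrow> bool" where
  "parabolic_eq s T \<Omega> u f \<longleftrightarrow>
     (\<exists>w\<in>L2_dual s T \<Omega>. weak_time_derivative s T \<Omega> (\<lambda>t. pivot \<Omega> (curry u t)) w \<and>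
        (\<forall>v\<in>sobolev0 s \<Omega>. AE t in lebesgue_on {0<..<T}.
           w t v + energy s (curry u t) v = pivot \<Omega> (curry f t) v))"

text \<open>
  On the closed cylinder, \<open>u\<close> is its continuous representative. In particular, \<open>u (0, x)\<close> is the
  initial value of \<open>u\<close>. The values on $(0,T) \times \partial\Omega$ need not vanish, since the
  elements of \<^const>\<open>sobolev0\<close> vanish only almost everywhere outside $\Omega$.
\<close>

definition U_space ::
  "real \<Rightarrow> real \<Rightarrow> real \<Rightarrow> real \<Rightarrow> 'a::euclidean_space set \<Rightarrow> (real \<times> 'a \<Rightarrow> real) set" where
  "U_space s r p T \<Omega> = {u \<in> U0_space s T \<Omega>.
     continuous_on (closure (cylinder T \<Omega>)) u \<and> (\<exists>f\<in>LrLp r p T \<Omega>. parabolic_eq s T \<Omega> u f)}"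

definition initial_zero :: "'a::euclidean_space set \<Rightarrow> (real \<times> 'a \<Rightarrow> real) \<Rightarrow> bool" where
  "initial_zero \<Omega> u \<longleftrightarrow> (AE x in lebesgue_on \<Omega>. u (0, x) = 0)"

definition state_equation :: "real \<Rightarrow> real \<Rightarrow> 'a::euclidean_space set \<Rightarrow>
    (real \<times> 'a \<Rightarrow> real) \<Rightarrow> (real \<times> 'a \<Rightarrow> real) \<Rightarrow> bool" where
  "state_equation s T \<Omega> u z \<longleftrightarrow> u \<in> U0_space s T \<Omega> \<and> initial_zero \<Omega> u \<and> parabolic_eq s T \<Omega> u z"


section \<open>Signed Radon measures\<close>

text \<open>
  Real-valued countably additive set functions on the Borel subsets of \<open>K\<close>; values on other sets
  are irrelevant. On a compact subset of a Euclidean space they are automatically regular.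
\<close>

definition radon_measures :: "'b::euclidean_space set \<Rightarrow> ('b set \<Rightarrow> real) set" where
  "radon_measures K = {\<mu>. \<forall>A :: nat \<Rightarrow> 'b set.
     range A \<subseteq> sets (restrict_space borel K) \<longrightarrow> disjoint_family A \<longrightarrow>
       (\<lambda>i. \<mu> (A i)) sums \<mu> (\<Union>i. A i)}"

text \<open>The positive part in the Jordan decomposition (\<open>ennreal\<close> maps negative numbers to 0).\<close>

definition positive_variation :: "'b::euclidean_space set \<Rightarrow> ('b set \<Rightarrow> real) \<Rightarrow> 'b measure" where
  "positive_variation K \<mu> = measure_of K (sets (restrict_space borel K))
     (\<lambda>A. SUP B\<in>{B \<in> sets (restrict_space borel K). B \<subseteq> A}. ennreal (\<mu> B))"

text \<open>The integral of \<open>v\<close> over \<open>A\<close>, i.e. with respect to the restriction of \<open>\<mu>\<close> to \<open>A\<close>.\<close>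

definition radon_integral ::
  "'b::euclidean_space set \<Rightarrow> ('b set \<Rightarrow> real) \<Rightarrow> 'b set \<Rightarrow> ('b \<Rightarrow> real) \<Rightarrow> real" where
  "radon_integral K \<mu> A v =
     (LINT q:A|positive_variation K \<mu>. v q) -
     (LINT q:A|positive_variation K (\<lambda>B. - \<mu> B). v q)"

definition zero_restriction :: "'b::euclidean_space set \<Rightarrow> ('b set \<Rightarrow> real) \<Rightarrow> 'b set \<Rightarrow> bool" where
  "zero_restriction K \<mu> A \<longleftrightarrow> (\<forall>B\<in>sets (restrict_space borel K). B \<subseteq> A \<longrightarrow> \<mu> B = 0)"


section \<open>The optimal control problems\<close>

definition L2Q_norm :: "real \<Rightarrow> 'a::euclidean_space set \<Rightarrow> (real \<times> 'a \<Rightarrow> real) \<Rightarrow> real" where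
  "L2Q_norm T \<Omega> f = lp_norm 2 (lebesgue_on (cylinder T \<Omega>)) f"

text \<open>Closedness also makes the set invariant under changes on null sets.\<close>

definition closed_in_LrLp ::
  "real \<Rightarrow> real \<Rightarrow> real \<Rightarrow> 'a::euclidean_space set \<Rightarrow> (real \<times> 'a \<Rightarrow> real) set \<Rightarrow> bool" where
  "closed_in_LrLp r p T \<Omega> Z \<longleftrightarrow>
     (\<forall>\<zeta> :: nat \<Rightarrow> real \<times> 'a \<Rightarrow> real. \<forall>z\<in>LrLp r p T \<Omega>.
        (\<forall>n. \<zeta> n \<in> Z) \<longrightarrow> (\<lambda>n. LrLp_norm r p T \<Omega> (\<lambda>q. \<zeta> n q - z q)) \<longlonglongrightarrow> 0 \<longrightarrow> z \<in> Z)"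

definition convex_fun_set :: "('c \<Rightarrow> real) set \<Rightarrow> bool" where
  "convex_fun_set Z \<longleftrightarrow>
     (\<forall>f\<in>Z. \<forall>g\<in>Z. \<forall>a\<ge>0. \<forall>b\<ge>0. a + b = 1 \<longrightarrow> (\<lambda>c. a * f c + b * g c) \<in> Z)"

definition cost :: "real \<Rightarrow> 'a::euclidean_space set \<Rightarrow> (real \<times> 'a \<Rightarrow> real) \<Rightarrow> real \<Rightarrow>
    (real \<times> 'a \<Rightarrow> real) \<Rightarrow> (real \<times> 'a \<Rightarrow> real) \<Rightarrow> real" where
  "cost T \<Omega> ud \<alpha> u z =
     1 / 2 * (L2Q_norm T \<Omega> (\<lambda>q. u q - ud q))\<^sup>2 + \<alpha> / 2 * (L2Q_norm T \<Omega> z)\<^sup>2"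

definition cost_reg :: "real \<Rightarrow> 'a::euclidean_space set \<Rightarrow> (real \<times> 'a \<Rightarrow> real) \<Rightarrow> real \<Rightarrow>
    (real \<times> 'a \<Rightarrow> real) \<Rightarrow> real \<Rightarrow> (real \<times> 'a \<Rightarrow> real) \<Rightarrow> (real \<times> 'a \<Rightarrow> real) \<Rightarrow> real" where
  "cost_reg T \<Omega> ud \<alpha> \<mu>h \<gamma> u z =
     cost T \<Omega> ud \<alpha> u z + 1 / (2 * \<gamma>) * (L2Q_norm T \<Omega> (\<lambda>q. max 0 (\<mu>h q + \<gamma> * u q)))\<^sup>2"

definition solves_constrained :: "real \<Rightarrow> real \<Rightarrow> real \<Rightarrow> real \<Rightarrow> 'a::euclidean_space set \<Rightarrow>
    (real \<times> 'a \<Rightarrow> real) set \<Rightarrow> (real \<times> 'a \<Rightarrow> real) \<Rightarrow> real \<Rightarrow>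
    (real \<times> 'a \<Rightarrow> real) \<Rightarrow> (real \<times> 'a \<Rightarrow> real) \<Rightarrow> bool" where
  "solves_constrained s r p T \<Omega> Zad ud \<alpha> u z \<longleftrightarrow>
     is_arg_min (\<lambda>(u, z). cost T \<Omega> ud \<alpha> u z)
       (\<lambda>(u, z). u \<in> U_space s r p T \<Omega> \<and> z \<in> LrLp r p T \<Omega> \<and> state_equation s T \<Omega> u z \<and>
          (\<forall>q\<in>closure (cylinder T \<Omega>). u q \<le> 0) \<and> z \<in> Zad)
       (u, z)"

definition solves_regularized :: "real \<Rightarrow> real \<Rightarrow> real \<Rightarrow> real \<Rightarrow> 'a::euclidean_space set \<Rightarrow>
    (real \<times> 'a \<Rightarrow> real) set \<Rightarrow> (real \<times> 'a \<Rightarrow> real) \<Rightarrow> real \<Rightarrow> (real \<times> 'a \<Rightarrow> real) \<Rightarrow> real \<Rightarrow>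
    (real \<times> 'a \<Rightarrow> real) \<Rightarrow> (real \<times> 'a \<Rightarrow> real) \<Rightarrow> bool" where
  "solves_regularized s r p T \<Omega> Zad ud \<alpha> \<mu>h \<gamma> u z \<longleftrightarrow>
     is_arg_min (\<lambda>(u, z). cost_reg T \<Omega> ud \<alpha> \<mu>h \<gamma> u z)
       (\<lambda>(u, z). u \<in> U_space s r p T \<Omega> \<and> z \<in> LrLp r p T \<Omega> \<and> state_equation s T \<Omega> u z \<and> z \<in> Zad)
       (u, z)"

text \<open>
  The adjoint equation in the very weak sense. The adjoint state \<open>\<xi>\<close> is a functional on
  $L^r((0,T);L^p(\Omega))$, so \<open>\<xi> f\<close> is the pairing $\int_Q \xi f\,dx\,dt$.
\<close>

definition adjoint_equation :: "real \<Rightarrow> real \<Rightarrow> real \<Rightarrow> real \<Rightarrow> 'a::euclidean_space set \<Rightarrow>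
    (real \<times> 'a \<Rightarrow> real) \<Rightarrow> (real \<times> 'a \<Rightarrow> real) \<Rightarrow> ((real \<times> 'a) set \<Rightarrow> real) \<Rightarrow>
    ((real \<times> 'a \<Rightarrow> real) \<Rightarrow> real) \<Rightarrow> bool" where
  "adjoint_equation s r p T \<Omega> ud u \<mu> \<xi> \<longleftrightarrow>
     (let Q = cylinder T \<Omega>; K = closure Q in
       zero_restriction K \<mu> ({0} \<times> closure \<Omega>) \<and>
       zero_restriction K \<mu> ({0<..<T} \<times> frontier \<Omega>) \<and>
       (\<forall>v\<in>U0_space s T \<Omega>. \<forall>f\<in>LrLp r p T \<Omega>.
          continuous_on K v \<longrightarrow> initial_zero \<Omega> v \<longrightarrow> parabolic_eq s T \<Omega> v f \<longrightarrow>
          \<xi> f = (LINT q|lebesgue_on Q. (u q - ud q) * v q)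
                 + radon_integral K \<mu> Q v + radon_integral K \<mu> ({T} \<times> closure \<Omega>) v))"

definition lagrange_multiplier :: "real \<Rightarrow> real \<Rightarrow> real \<Rightarrow> real \<Rightarrow> 'a::euclidean_space set \<Rightarrow>
    (real \<times> 'a \<Rightarrow> real) set \<Rightarrow> (real \<times> 'a \<Rightarrow> real) \<Rightarrow> real \<Rightarrow>
    (real \<times> 'a \<Rightarrow> real) \<Rightarrow> (real \<times> 'a \<Rightarrow> real) \<Rightarrow> ((real \<times> 'a) set \<Rightarrow> real) \<Rightarrow> bool" where
  "lagrange_multiplier s r p T \<Omega> Zad ud \<alpha> u z \<mu> \<longleftrightarrow>
     (let Q = cylinder T \<Omega>; K = closure Q in
       \<mu> \<in> radon_measures K \<and>
       (\<exists>\<xi>\<in>dual_space (LrLp r p T \<Omega>) (LrLp_norm r p T \<Omega>).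
          adjoint_equation s r p T \<Omega> ud u \<mu> \<xi> \<and>
          (\<forall>\<zeta>\<in>Zad. \<xi> (\<lambda>q. \<zeta> q - z q) + \<alpha> * (LINT q|lebesgue_on Q. z q * (\<zeta> q - z q)) \<ge> 0)) \<and>
       (\<forall>B\<in>sets (restrict_space borel K). 0 \<le> \<mu> B) \<and>
       (\<forall>q\<in>K. u q \<le> 0) \<and>
       radon_integral K \<mu> K u = 0)"

end

theory Submission
  imports Defs
begin

text \<open>
  Let $(\bar u, \bar z)$ and $(\bar u^\gamma, \bar z^\gamma)$ be the two solutions. The estimate is the sum
  of two first order conditions, each tested with the other solution.

  The multiplier gives, by lemma \<open>multiplier_inequality\<close>, with the measure integral of
  $\bar u$ vanishing by complementarity,
  $$0 \le \int_Q (\bar u - u_d)(\bar u^\gamma - \bar u) + \alpha \int_Q \bar z (\bar z^\gamma - \bar z)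
    + \langle \bar\mu, \bar u^\gamma \rangle .$$
  The pair $(\bar u, \bar z)$ is feasible for the regularised problem, whose solution therefore
  satisfies, by lemma \<open>solves_regularized_first_order\<close>,
  $$0 \le \int_Q (\bar u^\gamma - u_d)(\bar u - \bar u^\gamma)
    + \alpha \int_Q \bar z^\gamma (\bar z - \bar z^\gamma)
    + \int_Q (\hat\mu + \gamma \bar u^\gamma)_+ (\bar u - \bar u^\gamma) .$$
  In the sum the first two terms of each line combine to minus the squared distances, and the last
  integral is at most
  $\frac1\gamma \|\hat\mu\|^2 - \gamma \|(\bar u^\gamma)_+\|^2$, pointwise under the integral, by
  $\hat\mu \ge 0$ and $\bar u \le 0$ (lemma \<open>penalty_pointwise\<close>). This is the first estimate. The
  second one follows since $\langle \bar\mu, \bar u^\gamma \rangle \le \langle \bar\mu, (\bar u^\gamma)_+ \rangle$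
  for a nonnegative measure.

  The larger part of the work is to justify these manipulations. The state equation must be linear
  (lemma \<open>state_equation_lin\<close>), which amounts to the linear structure of the Bochner spaces over
  seminormed spaces of functions (locale \<open>function_seminorm\<close>) and to the integrability of all
  pairings; controls must be square integrable on the cylinder (lemma \<open>LrLp_subset_L2\<close>); and
  the integral against the multiplier must be an integral against a finite measure, which the
  zero restrictions in the adjoint equation concentrate on $Q$ and the final time (lemma
  \<open>radon_integral_split\<close>).
\<close>

section \<open>Elementary inequalities and limits\<close>

lemma powr_add_le:
  fixes x y q :: real
  assumes "0 \<le> x" "0 \<le> y" "0 \<le> q"
  shows "(x + y) powr q \<le> (2 * x) powr q + (2 * y) powr q"
proof -
  have "(x + y) powr q \<le> (max (2 * x) (2 * y)) powr q"
    using assms by (intro powr_mono2) auto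
  also have "\<dots> \<le> (2 * x) powr q + (2 * y) powr q"
    by (auto simp: max_def)
  finally show ?thesis .
qed

lemma LIMSEQ_zero_squeeze:
  fixes f g :: "nat \<Rightarrow> real"
  assumes "g \<longlonglongrightarrow> 0" "\<And>n. norm (f n) \<le> g n"
  shows "f \<longlonglongrightarrow> 0"
  using assms by (intro Lim_null_comparison[of f g]) auto

text \<open>
  Completeness of Lebesgue measure makes almost everywhere convergence sufficient. The norms and
  the evaluations of Bochner functions are only known to be such limits.
\<close>

lemma borel_measurable_AE_lim_lebesgue_on:
  fixes f :: "nat \<Rightarrow> 'b::euclidean_space \<Rightarrow> real"
  assumes S: "S \<in> sets lebesgue"
    and f: "\<And>n. f n \<in> borel_measurable (lebesgue_on S)"
    and lim: "AE x in lebesgue_on S. (\<lambda>n. f n x) \<longlonglongrightarrow> g x"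
  shows "g \<in> borel_measurable (lebesgue_on S)"
proof -
  \<comment> \<open>Extension by zero moves the problem to the whole space.\<close>
  let ?f = "\<lambda>n x. if x \<in> S then f n x else 0" and ?g = "\<lambda>x. if x \<in> S then g x else 0"
  have "(\<lambda>x. lim (\<lambda>n. ?f n x)) \<in> borel_measurable lebesgue"
    using f S by (intro borel_measurable_lim_metric) (simp add: borel_measurable_if)
  moreover have "AE x in lebesgue. lim (\<lambda>n. ?f n x) = ?g x"
    using lim S by (auto simp: AE_restrict_space_iff intro: limI elim!: eventually_mono)
  ultimately have "?g \<in> borel_measurable lebesgue"
    by (rule borel_measurable_AE)
  then show ?thesis
    using S by (simp add: borel_measurable_if)
qed

section \<open>Seminormed function spaces, their duals and Bochner spaces\<close>

text \<open>
  The common structure of the Lebesgue spaces, the space \<^const>\<open>sobolev0\<close> and its dual. The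
  single inequality for linear combinations contains both the triangle inequality and the
  homogeneity of the seminorm; definiteness is absent because the elements are representatives.
\<close>

locale function_seminorm =
  fixes X :: "('c \<Rightarrow> real) set" and nrm :: "('c \<Rightarrow> real) \<Rightarrow> real"
  assumes zero: "(\<lambda>c. 0) \<in> X"
    and lin: "f \<in> X \<Longrightarrow> g \<in> X \<Longrightarrow> (\<lambda>c. a * f c + b * g c) \<in> X"
    and nonneg: "f \<in> X \<Longrightarrow> 0 \<le> nrm f"
    and nrm_lin: "f \<in> X \<Longrightarrow> g \<in> X \<Longrightarrow> nrm (\<lambda>c. a * f c + b * g c) \<le> \<bar>a\<bar> * nrm f + \<bar>b\<bar> * nrm g"
begin

lemma diff: "f \<in> X \<Longrightarrow> g \<in> X \<Longrightarrow> (\<lambda>c. f c - g c) \<in> X"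
  using lin[of f g 1 "-1"] by simp

lemma nrm_diff_le: 
  assumes "f \<in> X" "g \<in> X"
  shows "\<bar>nrm f - nrm g\<bar> \<le> nrm (\<lambda>c. f c - g c)"
proof -
  have "nrm f \<le> nrm (\<lambda>c. f c - g c) + nrm g"
    using nrm_lin[OF diff[OF assms] assms(2), of 1 1] by simp
  moreover have "nrm g \<le> nrm (\<lambda>c. f c - g c) + nrm f"
    using nrm_lin[OF diff[OF assms] assms(1), of "-1" 1] by simp
  ultimately show ?thesis by linarith
qed

lemma nrm_scale:
  assumes "f \<in> X"
  shows "nrm (\<lambda>c. a * f c) = \<bar>a\<bar> * nrm f"
proof (cases "a = 0")
  case True
  then show ?thesis using nrm_lin[OF zero zero, of 0 0] nonneg[OF zero] by simp
next
  case False
  have 1: "(\<lambda>c. a * f c) \<in> X" using lin[OF assms zero, of a 0] by simp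
  have "nrm (\<lambda>c. a * f c) \<le> \<bar>a\<bar> * nrm f"
    using nrm_lin[OF assms zero, of a 0] by simp
  moreover have "nrm f \<le> \<bar>1/a\<bar> * nrm (\<lambda>c. a * f c)"
    using nrm_lin[OF 1 zero, of "1/a" 0] False by simp
  then have "\<bar>a\<bar> * nrm f \<le> nrm (\<lambda>c. a * f c)"
    using False by (simp add: field_simps)
  ultimately show ?thesis by simp
qed

text \<open>
  The reverse triangle inequality turns convergence of the approximating simple functions into
  convergence of their norms, which are simple real functions.
\<close>

lemma borel_measurable_nrm:
  fixes T :: real
  assumes S: "\<And>n. simple_function (lebesgue_on {0<..<T}) (S n)" "\<And>n. S n ` {0<..<T} \<subseteq> X"
    and lim: "AE t in lebesgue_on {0<..<T}. (\<lambda>n. nrm (\<lambda>c. S n t c - w t c)) \<longlonglongrightarrow> 0"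
    and w: "AE t in lebesgue_on {0<..<T}. w t \<in> X"
  shows "(\<lambda>t. nrm (w t)) \<in> borel_measurable (lebesgue_on {0<..<T})"
proof (rule borel_measurable_AE_lim_lebesgue_on)
  show "(\<lambda>t. nrm (S n t)) \<in> borel_measurable (lebesgue_on {0<..<T})" for n
    using simple_function_compose2[OF S(1)[of n] S(1)[of n], of "\<lambda>x y. nrm x"] by (rule borel_measurable_simple_function)
  show "AE t in lebesgue_on {0<..<T}. (\<lambda>n. nrm (S n t)) \<longlonglongrightarrow> nrm (w t)"
    using lim w AE_space
  proof eventually_elim
    case (elim t)
    have "norm (nrm (S n t) - nrm (w t)) \<le> nrm (\<lambda>c. S n t c - w t c)" for n
      using S(2)[of n] elim by (auto intro!: nrm_diff_le)
    then have "(\<lambda>n. nrm (S n t) - nrm (w t)) \<longlonglongrightarrow> 0"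
      by (rule LIMSEQ_zero_squeeze[OF elim(1)])
    then show ?case by (simp add: LIM_zero_iff)
  qed
qed auto

lemma bochner_space_lin:
  assumes q: "0 < q" and f: "f \<in> bochner_space q T X nrm" and g: "g \<in> bochner_space q T X nrm"
  shows "(\<lambda>t c. a * f t c + b * g t c) \<in> bochner_space q T X nrm"
proof -
  let ?I = "lebesgue_on {0<..<T}" and ?h = "\<lambda>t c. a * f t c + b * g t c"
  obtain F where F: "\<And>n. simple_function ?I (F n)" "\<And>n. F n ` {0<..<T} \<subseteq> X"
    "AE t in ?I. (\<lambda>n. nrm (\<lambda>c. F n t c - f t c)) \<longlonglongrightarrow> 0"
    and f': "AE t in ?I. f t \<in> X" "integrable ?I (\<lambda>t. nrm (f t) powr q)"
    using f unfolding bochner_space_def by blast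
  obtain G where G: "\<And>n. simple_function ?I (G n)" "\<And>n. G n ` {0<..<T} \<subseteq> X"
    "AE t in ?I. (\<lambda>n. nrm (\<lambda>c. G n t c - g t c)) \<longlonglongrightarrow> 0"
    and g': "AE t in ?I. g t \<in> X" "integrable ?I (\<lambda>t. nrm (g t) powr q)"
    using g unfolding bochner_space_def by blast
  define H where "H = (\<lambda>n t c. a * F n t c + b * G n t c)"
  have H1: "simple_function ?I (H n)" for n
    using simple_function_compose2[OF F(1)[of n] G(1)[of n], of "\<lambda>x y c. a * x c + b * y c"]
    by (simp add: H_def)
  have H2: "H n ` {0<..<T} \<subseteq> X" for n
    using F(2)[of n] G(2)[of n] by (auto simp: H_def intro!: lin)
  have H3: "AE t in ?I. (\<lambda>n. nrm (\<lambda>c. H n t c - ?h t c)) \<longlonglongrightarrow> 0"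
    using F(3) G(3) f'(1) g'(1) AE_space
  proof eventually_elim
    case (elim t)
    have X: "(\<lambda>c. F n t c - f t c) \<in> X" "(\<lambda>c. G n t c - g t c) \<in> X" for n
      using F(2)[of n] G(2)[of n] elim by (auto intro!: diff)
    have eq: "(\<lambda>c. H n t c - ?h t c) = (\<lambda>c. a * (F n t c - f t c) + b * (G n t c - g t c))" for n
      by (auto simp: H_def algebra_simps)
    have "(\<lambda>n. \<bar>a\<bar> * nrm (\<lambda>c. F n t c - f t c) + \<bar>b\<bar> * nrm (\<lambda>c. G n t c - g t c)) \<longlonglongrightarrow> 0"
      using tendsto_add[OF tendsto_mult_right[OF elim(1), of "\<bar>a\<bar>"] tendsto_mult_right[OF elim(2), of "\<bar>b\<bar>"]]
      by (simp add: mult.commute)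
    moreover have "norm (nrm (\<lambda>c. H n t c - ?h t c)) \<le> \<bar>a\<bar> * nrm (\<lambda>c. F n t c - f t c) + \<bar>b\<bar> * nrm (\<lambda>c. G n t c - g t c)" for n
      unfolding eq using nrm_lin[OF X[of n], of a b] nonneg[OF lin[OF X[of n], of a b]] by simp
    ultimately show ?case
      by (rule LIMSEQ_zero_squeeze)
  qed
  have h: "AE t in ?I. ?h t \<in> X"
    using f'(1) g'(1) by eventually_elim (rule lin)
  have "integrable ?I (\<lambda>t. nrm (?h t) powr q)"
  proof (rule Bochner_Integration.integrable_bound)
    show "integrable ?I (\<lambda>t. (2 * \<bar>a\<bar>) powr q * nrm (f t) powr q + (2 * \<bar>b\<bar>) powr q * nrm (g t) powr q)"
      using f' g' by auto
    show "(\<lambda>t. nrm (?h t) powr q) \<in> borel_measurable ?I"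
      using borel_measurable_nrm[OF H1 H2 H3 h] by measurable
    show "AE t in ?I. norm (nrm (?h t) powr q) \<le> norm ((2 * \<bar>a\<bar>) powr q * nrm (f t) powr q + (2 * \<bar>b\<bar>) powr q * nrm (g t) powr q)"
      using f'(1) g'(1) h
    proof eventually_elim
      case (elim t)
      let ?A = "\<bar>a\<bar> * nrm (f t)" and ?B = "\<bar>b\<bar> * nrm (g t)"
      have AB: "0 \<le> ?A" "0 \<le> ?B" using elim nonneg by auto
      have "nrm (?h t) powr q \<le> (?A + ?B) powr q"
        using q nonneg[OF elim(3)] nrm_lin[OF elim(1,2)] by (intro powr_mono2) auto
      also have "\<dots> \<le> (2 * ?A) powr q + (2 * ?B) powr q"
        using powr_add_le[OF AB, of q] q by simp
      also have "\<dots> = (2 * \<bar>a\<bar>) powr q * nrm (f t) powr q + (2 * \<bar>b\<bar>) powr q * nrm (g t) powr q"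
        using elim(1,2) nonneg by (simp add: powr_mult flip: mult.assoc)
      finally show ?case by simp
    qed
  qed
  then show ?thesis
    unfolding bochner_space_def using H1 H2 H3 h by blast
qed

text \<open>
  Seminorm zero is the notion of equality in these spaces. For functionals it only tests the
  values on the predual, which is what makes the lemma applicable to pivot functionals: the pivot functional of a sum is the sum
  of the pivot functionals only at arguments for which the integrals exist.
\<close>

lemma bochner_space_cong:
  assumes f: "f \<in> bochner_space q T X nrm"
    and g: "AE t in lebesgue_on {0<..<T}. g t \<in> X \<and> nrm (\<lambda>c. f t c - g t c) = 0"
  shows "g \<in> bochner_space q T X nrm"
proof -
  let ?I = "lebesgue_on {0<..<T}"
  obtain F where F: "\<And>n. simple_function ?I (F n)" "\<And>n. F n ` {0<..<T} \<subseteq> X"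
    "AE t in ?I. (\<lambda>n. nrm (\<lambda>c. F n t c - f t c)) \<longlonglongrightarrow> 0"
    and f': "AE t in ?I. f t \<in> X" "integrable ?I (\<lambda>t. nrm (f t) powr q)"
    using f unfolding bochner_space_def by blast
  have g1: "AE t in ?I. g t \<in> X" using g by auto
  have lim: "AE t in ?I. (\<lambda>n. nrm (\<lambda>c. F n t c - g t c)) \<longlonglongrightarrow> 0"
    using F(3) f'(1) g AE_space
  proof eventually_elim
    case (elim t)
    have X: "(\<lambda>c. F n t c - f t c) \<in> X" "(\<lambda>c. f t c - g t c) \<in> X" for n
      using F(2)[of n] elim by (auto intro!: diff)
    have "norm (nrm (\<lambda>c. F n t c - g t c)) \<le> nrm (\<lambda>c. F n t c - f t c)" for n
      using nrm_lin[OF X(1)[of n] X(2), of 1 1] nonneg[OF lin[OF X(1)[of n] X(2), of 1 1]] elim by simp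
    with elim(1) show ?case
      by (rule LIMSEQ_zero_squeeze)
  qed
  have "integrable ?I (\<lambda>t. nrm (f t) powr q) = integrable ?I (\<lambda>t. nrm (g t) powr q)"
  proof (rule integrable_cong_AE)
    show "(\<lambda>t. nrm (f t) powr q) \<in> borel_measurable ?I" using f' by auto
    show "(\<lambda>t. nrm (g t) powr q) \<in> borel_measurable ?I"
      using borel_measurable_nrm[OF F(1,2) lim g1] by measurable
    show "AE t in ?I. nrm (f t) powr q = nrm (g t) powr q"
      using f'(1) g by eventually_elim (use nrm_diff_le in fastforce)
  qed
  with f' F lim g1 show ?thesis
    unfolding bochner_space_def by blast
qed

lemma bochner_spaceD:
  assumes "f \<in> bochner_space q T X nrm"
  shows "AE t in lebesgue_on {0<..<T}. f t \<in> X"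
    and "integrable (lebesgue_on {0<..<T}) (\<lambda>t. nrm (f t) powr q)"
    and "(\<lambda>t. nrm (f t)) \<in> borel_measurable (lebesgue_on {0<..<T})"
  using assms borel_measurable_nrm unfolding bochner_space_def by blast+

lemma dual_norm_bdd:
  assumes "w \<in> dual_space X nrm"
  shows "bdd_above {\<bar>w f\<bar> | f. f \<in> X \<and> nrm f \<le> 1}"
proof -
  obtain C where "\<And>f. f \<in> X \<Longrightarrow> \<bar>w f\<bar> \<le> C * nrm f"
    using assms unfolding dual_space_def by blast
  moreover have "C * nrm f \<le> \<bar>C\<bar> * 1" if "f \<in> X" "nrm f \<le> 1" for f
    using that nonneg by (intro mult_mono) auto
  ultimately show ?thesis
    by (intro bdd_aboveI[of _ "\<bar>C\<bar> * 1"]) force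
qed

text \<open>
  The case of seminorm zero needs the boundedness of \<open>w\<close> directly, since such an \<open>f\<close> cannot be
  normalised.
\<close>

lemma dual_norm_bound:
  assumes w: "w \<in> dual_space X nrm" and f: "f \<in> X"
  shows "\<bar>w f\<bar> \<le> dual_norm X nrm w * nrm f"
proof (cases "nrm f = 0")
  case True
  then show ?thesis using w f unfolding dual_space_def by force
next
  case False
  then have pos: "0 < nrm f" using nonneg[OF f] by simp
  let ?g = "\<lambda>c. (1 / nrm f) * f c"
  have g: "?g \<in> X" "nrm ?g \<le> 1"
    using lin[OF f zero, of "1 / nrm f" 0] nrm_scale[OF f, of "1 / nrm f"] pos by auto
  have "w (\<lambda>c. (1 / nrm f) * f c + 0 * f c) = (1 / nrm f) * w f + 0 * w f"
    using w f unfolding dual_space_def by blast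
  then have "\<bar>w ?g\<bar> = \<bar>w f\<bar> / nrm f" using pos by (simp add: abs_mult)
  moreover have "\<bar>w ?g\<bar> \<le> dual_norm X nrm w"
    unfolding dual_norm_def using g by (intro cSup_upper dual_norm_bdd w) blast
  ultimately have "\<bar>w f\<bar> / nrm f \<le> dual_norm X nrm w" by simp
  then show ?thesis using pos by (simp add: pos_divide_le_eq)
qed

lemma dual_norm_least:
  assumes "\<And>f. f \<in> X \<Longrightarrow> nrm f \<le> 1 \<Longrightarrow> \<bar>w f\<bar> \<le> C"
  shows "dual_norm X nrm w \<le> C"
  unfolding dual_norm_def using assms zero nrm_scale[OF zero, of 0]
  by (intro cSup_least) auto

lemma dual_norm_nonneg: 
  assumes "w \<in> dual_space X nrm" shows "0 \<le> dual_norm X nrm w"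
proof -
  have "\<bar>w (\<lambda>c. 0)\<bar> \<le> dual_norm X nrm w"
    unfolding dual_norm_def using zero nrm_scale[OF zero, of 0]
    by (intro cSup_upper dual_norm_bdd assms) auto
  then show ?thesis by linarith
qed

lemma function_seminorm_dual: "function_seminorm (dual_space X nrm) (dual_norm X nrm)"
proof
  show "(\<lambda>c. 0) \<in> dual_space X nrm"
    unfolding dual_space_def by (auto intro: exI[of _ 0])
next
  fix f g a b assume f: "f \<in> dual_space X nrm" and g: "g \<in> dual_space X nrm"
  obtain C where C: "\<And>v. v \<in> X \<Longrightarrow> \<bar>f v\<bar> \<le> C * nrm v"
    using f unfolding dual_space_def by blast
  obtain D where D: "\<And>v. v \<in> X \<Longrightarrow> \<bar>g v\<bar> \<le> D * nrm v"
    using g unfolding dual_space_def by blast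
  have "\<bar>a * f v + b * g v\<bar> \<le> (\<bar>a\<bar> * C + \<bar>b\<bar> * D) * nrm v" if "v \<in> X" for v
  proof -
    have "\<bar>a * f v + b * g v\<bar> \<le> \<bar>a\<bar> * \<bar>f v\<bar> + \<bar>b\<bar> * \<bar>g v\<bar>"
      by (metis abs_mult abs_triangle_ineq)
    also have "\<dots> \<le> \<bar>a\<bar> * (C * nrm v) + \<bar>b\<bar> * (D * nrm v)"
      using C D that by (intro add_mono mult_left_mono) auto
    finally show ?thesis by (simp add: algebra_simps)
  qed
  moreover have "\<forall>v\<in>X. \<forall>v'\<in>X. \<forall>k l. a * f (\<lambda>c. k * v c + l * v' c) + b * g (\<lambda>c. k * v c + l * v' c)
      = k * (a * f v + b * g v) + l * (a * f v' + b * g v')"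
    using f g unfolding dual_space_def by (simp add: algebra_simps)
  ultimately show "(\<lambda>c. a * f c + b * g c) \<in> dual_space X nrm"
    unfolding dual_space_def by blast
  show "dual_norm X nrm (\<lambda>c. a * f c + b * g c) \<le> \<bar>a\<bar> * dual_norm X nrm f + \<bar>b\<bar> * dual_norm X nrm g"
  proof (rule dual_norm_least)
    fix v assume v: "v \<in> X" "nrm v \<le> 1"
    have "\<bar>f v\<bar> \<le> dual_norm X nrm f" "\<bar>g v\<bar> \<le> dual_norm X nrm g"
      using v dual_norm_bound[OF f v(1)] dual_norm_bound[OF g v(1)]
        mult_left_mono[OF v(2) dual_norm_nonneg[OF f]] mult_left_mono[OF v(2) dual_norm_nonneg[OF g]] by linarith+
    then have "\<bar>a\<bar> * \<bar>f v\<bar> + \<bar>b\<bar> * \<bar>g v\<bar> \<le> \<bar>a\<bar> * dual_norm X nrm f + \<bar>b\<bar> * dual_norm X nrm g"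
      by (intro add_mono mult_left_mono) auto
    then show "\<bar>a * f v + b * g v\<bar> \<le> \<bar>a\<bar> * dual_norm X nrm f + \<bar>b\<bar> * dual_norm X nrm g"
      using abs_triangle_ineq[of "a * f v" "b * g v"] by (simp add: abs_mult)
  qed
qed (rule dual_norm_nonneg)

lemma dual_space_cong:
  assumes w: "w \<in> dual_space X nrm" and eq: "\<And>f. f \<in> X \<Longrightarrow> w' f = w f"
  shows "w' \<in> dual_space X nrm" and "dual_norm X nrm (\<lambda>f. w f - w' f) = 0"
proof -
  have "\<forall>f\<in>X. \<forall>g\<in>X. \<forall>a b. w' (\<lambda>c. a * f c + b * g c) = a * w' f + b * w' g"
    using w eq lin unfolding dual_space_def by simp
  moreover have "\<exists>C. \<forall>f\<in>X. \<bar>w' f\<bar> \<le> C * nrm f"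
    using w eq unfolding dual_space_def by simp
  ultimately show w': "w' \<in> dual_space X nrm" by (simp add: dual_space_def)
  interpret D: function_seminorm "dual_space X nrm" "dual_norm X nrm"
    by (rule function_seminorm_dual)
  have "dual_norm X nrm (\<lambda>f. w f - w' f) \<le> 0"
    using eq by (intro dual_norm_least) simp
  then show "dual_norm X nrm (\<lambda>f. w f - w' f) = 0"
    using D.nonneg[OF D.diff[OF w w']] by simp
qed

text \<open>
  The integrals in \<^const>\<open>weak_time_derivative\<close> have the value 0 by convention when the
  integrand is not integrable. Their linearity therefore rests on this lemma: an evaluation is
  dominated by the dual norm, and $x \le 1 + x^2$ on an interval of finite length.
\<close>

lemma integrable_dual_eval:
  assumes w: "w \<in> bochner_space 2 T (dual_space X nrm) (dual_norm X nrm)" and v: "v \<in> X"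
  shows "integrable (lebesgue_on {0<..<T}) (\<lambda>t. w t v)"
proof -
  let ?I = "lebesgue_on {0<..<T}" and ?X = "dual_space X nrm" and ?n = "dual_norm X nrm"
  interpret D: function_seminorm ?X ?n by (rule function_seminorm_dual)
  interpret finite_measure ?I
    by (intro finite_measure_lebesgue_on) simp
  obtain F where F: "\<And>n. simple_function ?I (F n)" "\<And>n. F n ` {0<..<T} \<subseteq> ?X"
    "AE t in ?I. (\<lambda>n. ?n (\<lambda>c. F n t c - w t c)) \<longlonglongrightarrow> 0"
    using w unfolding bochner_space_def by blast
  have meas: "(\<lambda>t. w t v) \<in> borel_measurable ?I"
  proof (rule borel_measurable_AE_lim_lebesgue_on)
    show "(\<lambda>t. F n t v) \<in> borel_measurable ?I" for n
      using simple_function_compose2[OF F(1)[of n] F(1)[of n], of "\<lambda>x y. x v"] by (rule borel_measurable_simple_function)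
    show "AE t in ?I. (\<lambda>n. F n t v) \<longlonglongrightarrow> w t v"
      using F(3) D.bochner_spaceD(1)[OF w] AE_space
    proof eventually_elim
      case (elim t)
      have "norm (F n t v - w t v) \<le> ?n (\<lambda>c. F n t c - w t c) * nrm v" for n
        using dual_norm_bound[OF D.diff v, of "F n t" "w t"] F(2)[of n] elim by (simp add: image_subset_iff)
      moreover have "(\<lambda>n. ?n (\<lambda>c. F n t c - w t c) * nrm v) \<longlonglongrightarrow> 0"
        using tendsto_mult_right[OF elim(1), of "nrm v"] by simp
      ultimately have "(\<lambda>n. F n t v - w t v) \<longlonglongrightarrow> 0"
        by (rule LIMSEQ_zero_squeeze[rotated])
      then show ?case by (simp add: LIM_zero_iff)
    qed
  qed auto
  show ?thesis
  proof (rule Bochner_Integration.integrable_bound[OF _ meas])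
    show "integrable ?I (\<lambda>t. (1 + ?n (w t) powr 2) * nrm v)"
      using D.bochner_spaceD(2)[OF w] by auto
    show "AE t in ?I. norm (w t v) \<le> norm ((1 + ?n (w t) powr 2) * nrm v)"
      using D.bochner_spaceD(1)[OF w]
    proof eventually_elim
      case (elim t)
      have "?n (w t) \<le> 1 + (?n (w t))\<^sup>2"
        using sum_squares_bound[of "?n (w t)" "1::real"] D.nonneg[OF elim] by simp
      then have "?n (w t) \<le> 1 + ?n (w t) powr 2"
        using D.nonneg[OF elim] by simp
      then have "\<bar>w t v\<bar> \<le> (1 + ?n (w t) powr 2) * nrm v"
        using dual_norm_bound[OF elim v] nonneg[OF v] by (meson mult_right_mono order_trans)
      then show ?case by simp
    qed
  qed
qed

end

section \<open>Lebesgue spaces\<close>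

text \<open>
  If one of the two points is 0, the claim reduces to $k^p \le k$ for $k \in [0, 1]$; otherwise it
  is the convexity of the power on the positive numbers.
\<close>

lemma powr_convex_comb:
  fixes x y l p :: real
  assumes p: "1 \<le> p" and xy: "0 \<le> x" "0 \<le> y" and l: "0 \<le> l" "l \<le> 1"
  shows "(l * x + (1 - l) * y) powr p \<le> l * x powr p + (1 - l) * y powr p"
proof -
  have *: "(k * z) powr p \<le> k * z powr p" if "0 \<le> k" "k \<le> 1" "0 \<le> z" for k z :: real
  proof -
    have "k powr p \<le> k" 
      using that p powr_mono'[of 1 p k] by simp
    then show ?thesis using that by (simp add: powr_mult mult_right_mono)
  qed
  consider "x = 0" | "y = 0" | "0 < x" "0 < y" using xy by fastforce
  then show ?thesis
  proof cases
    case 3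
    have "convex_on {0<..} (\<lambda>x. x powr p)" using p by (rule powr_convex)
    from convex_onD[OF this, of "1 - l" x y] show ?thesis using 3 l by simp
  qed (use *[of "1-l" y] *[of l x] l xy p in auto)
qed

lemma lp_spaceD:
  assumes "f \<in> lp_space p M"
  shows "f \<in> borel_measurable M" "integrable M (\<lambda>x. \<bar>f x\<bar> powr p)"
  using assms by (auto simp: lp_space_def)

lemma lp_norm_nonneg: "0 \<le> lp_norm p M f"
  by (simp add: lp_norm_def)

lemma lp_norm_powr:
  assumes "0 < p"
  shows "lp_norm p M f powr p = (LINT x|M. \<bar>f x\<bar> powr p)"
  using assms by (simp add: lp_norm_def powr_powr integral_nonneg)

lemma lp_norm_scale:
  assumes "0 < p"
  shows "lp_norm p M (\<lambda>x. a * f x) = \<bar>a\<bar> * lp_norm p M f"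
  using assms by (simp add: lp_norm_def abs_mult powr_mult integral_nonneg powr_powr)

lemma lp_space_lin:
  assumes p: "0 < p" and f: "f \<in> lp_space p M" and g: "g \<in> lp_space p M"
  shows "(\<lambda>x. a * f x + b * g x) \<in> lp_space p M"
proof -
  note [measurable] = lp_spaceD(1)[OF f] lp_spaceD(1)[OF g]
  have "integrable M (\<lambda>x. \<bar>a * f x + b * g x\<bar> powr p)"
  proof (rule Bochner_Integration.integrable_bound)
    show "integrable M (\<lambda>x. (2 * \<bar>a\<bar>) powr p * \<bar>f x\<bar> powr p + (2 * \<bar>b\<bar>) powr p * \<bar>g x\<bar> powr p)"
      using lp_spaceD(2)[OF f] lp_spaceD(2)[OF g] by auto
    have "\<bar>a * f x + b * g x\<bar> powr p \<le> (2 * \<bar>a\<bar>) powr p * \<bar>f x\<bar> powr p + (2 * \<bar>b\<bar>) powr p * \<bar>g x\<bar> powr p" for x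
    proof -
      have "\<bar>a * f x + b * g x\<bar> powr p \<le> (\<bar>a\<bar> * \<bar>f x\<bar> + \<bar>b\<bar> * \<bar>g x\<bar>) powr p"
        using p abs_triangle_ineq[of "a * f x" "b * g x"] by (intro powr_mono2) (auto simp: abs_mult)
      also have "\<dots> \<le> (2 * (\<bar>a\<bar> * \<bar>f x\<bar>)) powr p + (2 * (\<bar>b\<bar> * \<bar>g x\<bar>)) powr p"
        using p by (intro powr_add_le) auto
      finally show ?thesis by (simp add: powr_mult flip: mult.assoc)
    qed
    then show "AE x in M. norm (\<bar>a * f x + b * g x\<bar> powr p) \<le> norm ((2 * \<bar>a\<bar>) powr p * \<bar>f x\<bar> powr p + (2 * \<bar>b\<bar>) powr p * \<bar>g x\<bar> powr p)"
      by simp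
  qed measurable
  then show ?thesis by (simp add: lp_space_def)
qed

text \<open>
  Minkowski's inequality by convexity: if $A$ and $B$ exceed the norms of $f$ and $g$, then
  $(|f| + |g|) / (A + B)$ is a convex combination of $|f| / A$ and $|g| / B$, so the integral of
  its \<open>p\<close>-th power is at most one. Adding \<open>e / 2\<close> to the norms avoids division by zero.
\<close>

lemma lp_norm_triangle:
  assumes p: "1 \<le> p" and f: "f \<in> lp_space p M" and g: "g \<in> lp_space p M"
  shows "lp_norm p M (\<lambda>x. f x + g x) \<le> lp_norm p M f + lp_norm p M g"
proof (rule field_le_epsilon)
  fix e :: real assume e: "0 < e"
  define A where "A = lp_norm p M f + e / 2"
  define B where "B = lp_norm p M g + e / 2"
  have A: "lp_norm p M f \<le> A" "0 < A" and B: "lp_norm p M g \<le> B" "0 < B"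
    using e lp_norm_nonneg[of p M f] lp_norm_nonneg[of p M g] by (auto simp: A_def B_def)
  define l where "l = A / (A + B)"
  have l: "0 \<le> l" "l \<le> 1" "1 - l = B / (A + B)"
    using A B by (auto simp: l_def field_simps)
  let ?c = "(A + B) powr p * l / A powr p" and ?d = "(A + B) powr p * (1 - l) / B powr p"
  have pointwise: "\<bar>f x + g x\<bar> powr p \<le> ?c * \<bar>f x\<bar> powr p + ?d * \<bar>g x\<bar> powr p" for x
  proof -
    have "\<bar>f x\<bar> + \<bar>g x\<bar> = (A + B) * (l * (\<bar>f x\<bar> / A) + (1 - l) * (\<bar>g x\<bar> / B))"
    proof -
      have "(A + B) * (l * (\<bar>f x\<bar> / A)) = \<bar>f x\<bar>" "(A + B) * ((1 - l) * (\<bar>g x\<bar> / B)) = \<bar>g x\<bar>"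
        unfolding l(3) using A B by (auto simp: l_def)
      then show ?thesis unfolding distrib_left by simp
    qed
    then have "\<bar>f x + g x\<bar> powr p \<le> ((A + B) * (l * (\<bar>f x\<bar> / A) + (1 - l) * (\<bar>g x\<bar> / B))) powr p"
      using p abs_triangle_ineq[of "f x" "g x"] by (intro powr_mono2) auto
    also have "\<dots> = (A + B) powr p * (l * (\<bar>f x\<bar> / A) + (1 - l) * (\<bar>g x\<bar> / B)) powr p"
      using A B l by (intro powr_mult) 
    also have "\<dots> \<le> (A + B) powr p * (l * (\<bar>f x\<bar> / A) powr p + (1 - l) * (\<bar>g x\<bar> / B) powr p)"
      using A B l p by (intro mult_left_mono powr_convex_comb) auto
    also have "\<dots> = ?c * \<bar>f x\<bar> powr p + ?d * \<bar>g x\<bar> powr p"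
      using A B by (simp add: powr_divide algebra_simps)
    finally show ?thesis .
  qed
  have sum: "(\<lambda>x. f x + g x) \<in> lp_space p M"
    using lp_space_lin[OF _ f g, of 1 1] p by simp
  have le: "(LINT x|M. \<bar>f x\<bar> powr p) \<le> A powr p" "(LINT x|M. \<bar>g x\<bar> powr p) \<le> B powr p"
    using p A B lp_norm_nonneg by (auto simp flip: lp_norm_powr intro!: powr_mono2)
  have "(LINT x|M. \<bar>f x + g x\<bar> powr p) \<le> (LINT x|M. ?c * \<bar>f x\<bar> powr p + ?d * \<bar>g x\<bar> powr p)"
    using lp_spaceD(2)[OF f] lp_spaceD(2)[OF g] lp_spaceD(2)[OF sum] pointwise
    by (intro integral_mono) auto
  also have "\<dots> = ?c * (LINT x|M. \<bar>f x\<bar> powr p) + ?d * (LINT x|M. \<bar>g x\<bar> powr p)"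
    using lp_spaceD(2)[OF f] lp_spaceD(2)[OF g] by simp
  also have "\<dots> \<le> ?c * A powr p + ?d * B powr p"
    using le l A B by (intro add_mono mult_left_mono) auto
  also have "\<dots> = (A + B) powr p * (l + (1 - l))"
    unfolding distrib_left using A B by simp
  finally have "lp_norm p M (\<lambda>x. f x + g x) powr p \<le> (A + B) powr p"
    using p by (simp add: lp_norm_powr)
  then have "(lp_norm p M (\<lambda>x. f x + g x) powr p) powr (1/p) \<le> ((A + B) powr p) powr (1/p)"
    by (rule powr_mono2[rotated 2]) (use p in auto)
  then have "lp_norm p M (\<lambda>x. f x + g x) \<le> A + B"
    using p A B lp_norm_nonneg[of p M "\<lambda>x. f x + g x"] by (simp add: powr_powr)
  then show "lp_norm p M (\<lambda>x. f x + g x) \<le> lp_norm p M f + lp_norm p M g + e"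
    by (simp add: A_def B_def)
qed

lemma function_seminorm_lp:
  assumes "1 \<le> p"
  shows "function_seminorm (lp_space p M) (lp_norm p M)"
proof
  show "(\<lambda>c. 0) \<in> lp_space p M"
    by (simp add: lp_space_def)
next
  fix f g a b assume fg: "f \<in> lp_space p M" "g \<in> lp_space p M"
  show "(\<lambda>c. a * f c + b * g c) \<in> lp_space p M"
    using assms fg by (intro lp_space_lin) auto
  have "(\<lambda>c. k * h c) \<in> lp_space p M" if "h \<in> lp_space p M" for h k
    using assms that lp_space_lin[of p h M h k 0] by simp
  from lp_norm_triangle[OF assms this[OF fg(1)] this[OF fg(2)]]
  show "lp_norm p M (\<lambda>c. a * f c + b * g c) \<le> \<bar>a\<bar> * lp_norm p M f + \<bar>b\<bar> * lp_norm p M g"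
    using assms by (simp add: lp_norm_scale)
qed (rule lp_norm_nonneg)

lemma lp_space_2_iff: "f \<in> lp_space 2 M \<longleftrightarrow> f \<in> borel_measurable M \<and> integrable M (\<lambda>x. (f x)\<^sup>2)"
  by (simp add: lp_space_def)

lemma lp_norm_2_power2: "(lp_norm 2 M f)\<^sup>2 = (LINT x|M. (f x)\<^sup>2)"
  using lp_norm_powr[of 2 M f] lp_norm_nonneg[of 2 M f] by simp

lemma integrable_mult_L2:
  assumes f: "f \<in> lp_space 2 M" and g: "g \<in> lp_space 2 M"
  shows "integrable M (\<lambda>x. f x * g x)"
proof (rule Bochner_Integration.integrable_bound)
  show "integrable M (\<lambda>x. (f x)\<^sup>2 + (g x)\<^sup>2)"
    using f g by (auto simp: lp_space_2_iff)
  show "(\<lambda>x. f x * g x) \<in> borel_measurable M"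
    using f g by (auto simp: lp_space_2_iff)
  have "\<bar>f x * g x\<bar> \<le> (f x)\<^sup>2 + (g x)\<^sup>2" for x
  proof -
    have "2 * \<bar>f x\<bar> * \<bar>g x\<bar> \<le> (f x)\<^sup>2 + (g x)\<^sup>2"
      using sum_squares_bound[of "\<bar>f x\<bar>" "\<bar>g x\<bar>"] by simp
    moreover have "0 \<le> \<bar>f x\<bar> * \<bar>g x\<bar>" by simp
    ultimately show ?thesis unfolding abs_mult by linarith
  qed
  then show "AE x in M. norm (f x * g x) \<le> norm ((f x)\<^sup>2 + (g x)\<^sup>2)" by simp
qed

text \<open>
  Hoelder's inequality with a non-optimal constant: integrate $|f/a|^2 \le 1 + |f/a|^p$ for
  $a$ the norm of $f$. The scaling by $a$ gives a bound by a square of the norm, so that the time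
  integral later needs only the exponent $r \ge 2$, whatever $p$ is.
\<close>

lemma lp_space_finite_measure_L2:
  assumes M: "finite_measure M" and p: "2 \<le> p" and f: "f \<in> lp_space p M"
  shows "f \<in> lp_space 2 M"
    and "(LINT x|M. (f x)\<^sup>2) \<le> (measure M (space M) + 1) * (lp_norm p M f)\<^sup>2"
proof -
  interpret finite_measure M by (rule M)
  note [measurable] = lp_spaceD(1)[OF f]
  have sq: "z\<^sup>2 \<le> 1 + \<bar>z\<bar> powr p" for z :: real
  proof (cases "\<bar>z\<bar> \<le> 1")
    case True
    then have "z\<^sup>2 \<le> 1" by (simp add: abs_square_le_1)
    then show ?thesis using powr_ge_zero[of "\<bar>z\<bar>" p] by linarith
  next
    case False
    then have "\<bar>z\<bar> powr 2 \<le> \<bar>z\<bar> powr p" using p by (intro powr_mono) auto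
    then show ?thesis by simp
  qed
  have int: "integrable M (\<lambda>x. 1 + \<bar>f x / a\<bar> powr p)" for a
    using lp_spaceD(2)[OF f] by (simp add: powr_divide)
  have int2: "integrable M (\<lambda>x. (f x / a)\<^sup>2)" for a
    by (rule Bochner_Integration.integrable_bound[OF int[of a]]) (use sq[of "f x / a" for x] in auto)
  from int2[of 1] show "f \<in> lp_space 2 M" by (simp add: lp_space_2_iff)
  define a where "a = lp_norm p M f"
  show "(LINT x|M. (f x)\<^sup>2) \<le> (measure M (space M) + 1) * (lp_norm p M f)\<^sup>2"
  proof (cases "a = 0")
    case True
    then have "(LINT x|M. \<bar>f x\<bar> powr p) = 0"
      using p lp_norm_powr[of p M f] by (simp add: a_def)
    then have "AE x in M. \<bar>f x\<bar> powr p = 0"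
      using lp_spaceD(2)[OF f] by (subst (asm) integral_nonneg_eq_0_iff_AE) auto
    then have "(LINT x|M. (f x)\<^sup>2) = (LINT x|M. 0)"
      by (intro integral_cong_AE) auto
    then show ?thesis by simp
  next
    case False
    then have a: "0 < a" using lp_norm_nonneg[of p M f] by (simp add: a_def)
    have "(LINT x|M. (f x / a)\<^sup>2) \<le> (LINT x|M. 1 + \<bar>f x / a\<bar> powr p)"
      by (intro integral_mono int int2 sq)
    also have "\<dots> = measure M (space M) + (LINT x|M. \<bar>f x\<bar> powr p) / a powr p"
      using a lp_spaceD(2)[OF f] by (simp add: powr_divide)
    also have "\<dots> = measure M (space M) + 1"
      using a p by (simp add: a_def flip: lp_norm_powr)
    finally show ?thesis
      using a by (simp add: power_divide field_simps flip: a_def)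
  qed
qed

section \<open>Fractional Sobolev spaces\<close>

text \<open>
  The square of this function is the integrand of the Gagliardo seminorm. As a linear map into
  $L^2$ of the product space it reduces the Sobolev norm and the energy form to Lebesgue spaces.
\<close>

definition difference_quotient :: "real \<Rightarrow> ('a::euclidean_space \<Rightarrow> real) \<Rightarrow> 'a \<times> 'a \<Rightarrow> real" where
  "difference_quotient s u =
     (\<lambda>(x, y). (u x - u y) / norm (x - y) powr ((real DIM('a) + 2 * s) / 2))"

lemma difference_quotient_mult:
  fixes u v :: "'a::euclidean_space \<Rightarrow> real"
  shows "difference_quotient s u q * difference_quotient s v q =
    (case q of (x, y) \<Rightarrow> (u x - u y) * (v x - v y) / norm (x - y) powr (real DIM('a) + 2 * s))"
  by (cases q) (simp add: difference_quotient_def flip: powr_add)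

lemma difference_quotient_power2:
  fixes u :: "'a::euclidean_space \<Rightarrow> real"
  shows "(difference_quotient s u q)\<^sup>2 =
    (case q of (x, y) \<Rightarrow> \<bar>u x - u y\<bar>\<^sup>2 / norm (x - y) powr (real DIM('a) + 2 * s))"
  using difference_quotient_mult[of s u q u] by (cases q) (simp add: power2_eq_square)

lemma difference_quotient_lin:
  "difference_quotient s (\<lambda>x. a * u x + b * v x) =
    (\<lambda>q. a * difference_quotient s u q + b * difference_quotient s v q)"
  by (auto simp: difference_quotient_def algebra_simps add_divide_distrib diff_divide_distrib)

text \<open>
  Lebesgue measure on the product is not the product of the Lebesgue measures, so the projections
  have to be shown to pull null sets back to null sets.
\<close>

lemma measurable_lebesgue_fst_snd:
  fixes u :: "'a::euclidean_space \<Rightarrow> real"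
  assumes "u \<in> borel_measurable lebesgue"
  shows "(\<lambda>q. u (fst q)) \<in> borel_measurable (lebesgue :: ('a \<times> 'a) measure)"
    and "(\<lambda>q. u (snd q)) \<in> borel_measurable (lebesgue :: ('a \<times> 'a) measure)"
proof -
  let ?L = "lebesgue :: ('a \<times> 'a) measure"
  have null: "A \<in> null_sets lborel \<Longrightarrow> A \<times> UNIV \<in> null_sets (lborel :: ('a \<times> 'a) measure)"
    "A \<in> null_sets lborel \<Longrightarrow> UNIV \<times> A \<in> null_sets (lborel :: ('a \<times> 'a) measure)" for A :: "'a set"
    by (auto simp: null_sets_def lborel.emeasure_pair_measure_Times simp flip: lborel_prod)
  have fst: "fst \<in> ?L \<rightarrow>\<^sub>M lborel" and snd: "snd \<in> ?L \<rightarrow>\<^sub>M lborel"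
    by (auto intro!: measurable_completion borel_measurable_continuous_onI continuous_on_fst continuous_on_snd)
  have "fst \<in> ?L \<rightarrow>\<^sub>M lebesgue"
  proof (rule completion.measurable_completion2[OF fst], safe)
    fix A :: "'a set" assume A: "A \<in> null_sets lborel"
    have "fst -` A \<inter> space ?L = A \<times> UNIV" by auto
    with null(1)[OF A] A fst show "A \<in> null_sets (distr ?L lborel fst)"
      by (auto simp: null_sets_def emeasure_distr)
  qed
  then show "(\<lambda>q. u (fst q)) \<in> borel_measurable ?L"
    using assms by (rule measurable_compose)
  have "snd \<in> ?L \<rightarrow>\<^sub>M lebesgue"
  proof (rule completion.measurable_completion2[OF snd], safe)
    fix A :: "'a set" assume A: "A \<in> null_sets lborel"
    have "snd -` A \<inter> space ?L = UNIV \<times> A" by auto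
    with null(2)[OF A] A snd show "A \<in> null_sets (distr ?L lborel snd)"
      by (auto simp: null_sets_def emeasure_distr)
  qed
  then show "(\<lambda>q. u (snd q)) \<in> borel_measurable ?L"
    using assms by (rule measurable_compose)
qed

lemma borel_measurable_difference_quotient:
  assumes "u \<in> borel_measurable lebesgue"
  shows "difference_quotient s u \<in> borel_measurable lebesgue"
proof -
  note [measurable] = measurable_lebesgue_fst_snd[OF assms]
  have [measurable]: "(\<lambda>q::'a \<times> 'a. norm (fst q - snd q)) \<in> borel_measurable lebesgue"
    by (intro measurable_completion) (auto intro!: borel_measurable_continuous_onI continuous_intros)
  show ?thesis
    unfolding difference_quotient_def split_beta by measurable
qed

lemma sobolev_iff:
  fixes u :: "'a::euclidean_space \<Rightarrow> real"
  shows
  "u \<in> sobolev s \<longleftrightarrow> u \<in> lp_space 2 lebesgue \<and> difference_quotient s u \<in> lp_space 2 lebesgue"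
proof -
  have "difference_quotient s u \<in> lp_space 2 lebesgue \<longleftrightarrow>
      difference_quotient s u \<in> borel_measurable lebesgue \<and>
      integrable (lebesgue :: ('a \<times> 'a) measure)
        (\<lambda>(x, y). \<bar>u x - u y\<bar>\<^sup>2 / norm (x - y) powr (real DIM('a) + 2 * s))"
    unfolding lp_space_2_iff difference_quotient_power2 by (rule refl)
  then show ?thesis
    unfolding sobolev_def using borel_measurable_difference_quotient lp_spaceD(1) by blast
qed

lemma sobolev_norm_eq:
  "sobolev_norm s u = sqrt ((lp_norm 2 lebesgue u)\<^sup>2 + (lp_norm 2 lebesgue (difference_quotient s u))\<^sup>2)"
  unfolding sobolev_norm_def lp_norm_2_power2 difference_quotient_power2 by simp

lemma energy_eq:
  fixes u v :: "'a::euclidean_space \<Rightarrow> real"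
  shows "energy s u v = frac_const DIM('a) s / 2 *
     (LINT q|lebesgue. difference_quotient s u q * difference_quotient s v q)"
  unfolding energy_def difference_quotient_mult by (rule refl)

lemma energy_lin:
  assumes "u \<in> sobolev s" "u' \<in> sobolev s" "v \<in> sobolev s"
  shows "energy s (\<lambda>x. a * u x + b * u' x) v = a * energy s u v + b * energy s u' v"
proof -
  have "integrable lebesgue (\<lambda>q. difference_quotient s u q * difference_quotient s v q)"
    "integrable lebesgue (\<lambda>q. difference_quotient s u' q * difference_quotient s v q)"
    using assms by (auto simp: sobolev_iff intro!: integrable_mult_L2)
  then show ?thesis
    by (simp add: energy_eq difference_quotient_lin algebra_simps)
qed

text \<open>
  Minkowski's inequality in $L^2$ for the function and for its difference quotient, combined by
  the triangle inequality in the plane.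
\<close>

lemma function_seminorm_sobolev0: "function_seminorm (sobolev0 s \<Omega>) (sobolev_norm s)"
proof
  interpret L: function_seminorm "lp_space 2 M" "lp_norm 2 M" for M
    by (rule function_seminorm_lp) simp
  show "(\<lambda>c. 0) \<in> sobolev0 s \<Omega>"
    using difference_quotient_lin[of s 0 "\<lambda>_::'a. 0" 0 "\<lambda>_. 0"] by (simp add: sobolev0_def sobolev_iff L.zero)
  show "0 \<le> sobolev_norm s f" for f :: "'a \<Rightarrow> real" by (simp add: sobolev_norm_eq)
  fix f g :: "'a \<Rightarrow> real" and a b assume fg: "f \<in> sobolev0 s \<Omega>" "g \<in> sobolev0 s \<Omega>"
  then have ae: "AE x in lebesgue. x \<notin> \<Omega> \<longrightarrow> f x = 0" "AE x in lebesgue. x \<notin> \<Omega> \<longrightarrow> g x = 0"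
    by (auto simp: sobolev0_def)
  have "AE x in lebesgue. x \<notin> \<Omega> \<longrightarrow> a * f x + b * g x = 0"
    using ae by eventually_elim auto
  with fg show "(\<lambda>c. a * f c + b * g c) \<in> sobolev0 s \<Omega>"
    by (auto simp: sobolev0_def sobolev_iff difference_quotient_lin intro!: L.lin)
  let ?n = "lp_norm 2 lebesgue" and ?m = "lp_norm 2 lebesgue" and ?D = "difference_quotient s"
  let ?c = "\<lambda>c. a * f c + b * g c"
  have nn: "0 \<le> lp_norm 2 M h" for M and h :: "'z \<Rightarrow> real" by (rule lp_norm_nonneg)
  have "sobolev_norm s ?c \<le> sqrt ((\<bar>a\<bar> * ?n f + \<bar>b\<bar> * ?n g)\<^sup>2 + (\<bar>a\<bar> * ?m (?D f) + \<bar>b\<bar> * ?m (?D g))\<^sup>2)"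
    unfolding sobolev_norm_eq difference_quotient_lin
    using fg nn by (intro real_sqrt_le_mono add_mono power_mono L.nrm_lin) (auto simp: sobolev0_def sobolev_iff lp_norm_nonneg)
  also have "\<dots> \<le> sqrt ((\<bar>a\<bar> * ?n f)\<^sup>2 + (\<bar>a\<bar> * ?m (?D f))\<^sup>2) + sqrt ((\<bar>b\<bar> * ?n g)\<^sup>2 + (\<bar>b\<bar> * ?m (?D g))\<^sup>2)"
    by (rule real_sqrt_sum_squares_triangle_ineq)
  also have "\<dots> = \<bar>a\<bar> * sobolev_norm s f + \<bar>b\<bar> * sobolev_norm s g"
    by (simp add: sobolev_norm_eq power_mult_distrib real_sqrt_mult flip: distrib_left)
  finally show "sobolev_norm s ?c \<le> \<bar>a\<bar> * sobolev_norm s f + \<bar>b\<bar> * sobolev_norm s g" .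
qed

section \<open>Controls are square integrable on the cylinder\<close>

lemma curry_lin: "curry (\<lambda>q. a * u q + b * v q) = (\<lambda>t c. a * curry u t c + b * curry v t c)"
  by (simp add: curry_def)

lemma LrLp_lin:
  assumes "1 \<le> p" "0 < r" "f \<in> LrLp r p T \<Omega>" "g \<in> LrLp r p T \<Omega>"
  shows "(\<lambda>q. a * f q + b * g q) \<in> LrLp r p T \<Omega>"
proof -
  interpret function_seminorm "lp_space p (lebesgue_on \<Omega>)" "lp_norm p (lebesgue_on \<Omega>)"
    using assms(1) by (rule function_seminorm_lp)
  show ?thesis
    using assms unfolding LrLp_def by (auto simp: curry_lin simp del: curry_conv intro!: bochner_space_lin)
qed

lemma lp_space_restrict:
  assumes "f \<in> lp_space p lebesgue" "S \<in> sets lebesgue"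
  shows "f \<in> lp_space p (lebesgue_on S)"
  using assms by (auto simp: lp_space_def measurable_restrict_space1 integrable_restrict_space
      intro!: integrable_real_mult_indicator simp: mult.commute[of "indicator _ _"])

lemma cylinder_lmeasurable:
  assumes "open \<Omega>" "bounded \<Omega>"
  shows "cylinder T \<Omega> \<in> lmeasurable" "\<Omega> \<in> lmeasurable"
  using assms unfolding cylinder_def
  by (auto intro!: lmeasurable_open bounded_Times open_Times)

lemma LrLp_slice_L2:
  assumes \<Omega>: "open \<Omega>" "bounded \<Omega>" and p: "2 \<le> p" and z: "z \<in> LrLp r p T \<Omega>"
  shows "AE t in lebesgue_on {0<..<T}. curry z t \<in> lp_space 2 (lebesgue_on \<Omega>)"
proof -
  interpret function_seminorm "lp_space p (lebesgue_on \<Omega>)" "lp_norm p (lebesgue_on \<Omega>)"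
    using p by (intro function_seminorm_lp) simp
  have "finite_measure (lebesgue_on \<Omega>)"
    using \<Omega> by (intro finite_measure_lebesgue_on cylinder_lmeasurable)
  note lp_space_finite_measure_L2(1)[OF this p]
  moreover have "AE t in lebesgue_on {0<..<T}. curry z t \<in> lp_space p (lebesgue_on \<Omega>)"
    using z unfolding LrLp_def by (auto dest: bochner_spaceD)
  ultimately show ?thesis by (auto elim: eventually_mono)
qed

text \<open>
  Without this the norm of a control in the cost functional would be 0 by convention. It is the
  Tonelli theorem together with the inclusions of $L^p$ and $L^r$ into $L^2$ on bounded sets.
  Since Lebesgue measurable functions on the cylinder need not have measurable sections, the
  iterated integral is taken of a Borel version \<open>g\<close>, almost all sections of which agree almost
  everywhere with those of \<open>z\<close>.
\<close>

lemma LrLp_subset_L2: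
  fixes \<Omega> :: "'a::euclidean_space set"
  assumes \<Omega>: "open \<Omega>" "bounded \<Omega>" and p: "2 \<le> p" and r: "2 \<le> r" and z: "z \<in> LrLp r p T \<Omega>"
  shows "z \<in> lp_space 2 (lebesgue_on (cylinder T \<Omega>))"
proof -
  let ?Q = "cylinder T \<Omega>" and ?I = "lebesgue_on {0<..<T}" and ?n = "lp_norm p (lebesgue_on \<Omega>)"
  interpret function_seminorm "lp_space p (lebesgue_on \<Omega>)" ?n
    using p by (intro function_seminorm_lp) simp
  interpret I: finite_measure ?I
    by (intro finite_measure_lebesgue_on) simp
  have fin: "finite_measure (lebesgue_on \<Omega>)"
    using \<Omega> by (intro finite_measure_lebesgue_on cylinder_lmeasurable)
  have Q: "?Q \<in> sets lebesgue" "\<Omega> \<in> sets lebesgue"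
    using cylinder_lmeasurable[OF \<Omega>] by (auto intro: fmeasurableD)
  have zm: "z \<in> borel_measurable (lebesgue_on ?Q)"
    and zb: "curry z \<in> bochner_space r T (lp_space p (lebesgue_on \<Omega>)) ?n"
    using z by (auto simp: LrLp_def)
  define y where "y = (\<lambda>q. if q \<in> ?Q then z q else 0)"
  have ym: "y \<in> borel_measurable lebesgue"
    using zm Q by (simp add: y_def borel_measurable_if)
  then obtain g where g: "g \<in> borel_measurable lborel" "AE q in lborel. y q = g q"
    using completion_ex_borel_measurable_real by blast
  have slices: "AE t in lborel. AE x in lborel. y (t, x) = g (t, x)"
    by (rule lborel_pair.AE_pair) (unfold lborel_prod, rule g(2))
  define C where "C = measure (lebesgue_on \<Omega>) (space (lebesgue_on \<Omega>)) + 1"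
  have C: "0 \<le> C" by (simp add: C_def)
  have slice_bound: "AE t in ?I. (\<integral>\<^sup>+x. ennreal ((y (t, x))\<^sup>2) \<partial>lborel) \<le> ennreal (C * (1 + ?n (curry z t) powr r))"
    using bochner_spaceD(1)[OF zb] AE_space
  proof eventually_elim
    case (elim t)
    note L2 = lp_space_finite_measure_L2[OF fin p elim(1)]
    let ?a = "?n (curry z t)"
    have "(\<integral>\<^sup>+x. ennreal ((y (t, x))\<^sup>2) \<partial>lborel) = (\<integral>\<^sup>+x. ennreal ((y (t, x))\<^sup>2) \<partial>lebesgue)"
      by (simp add: nn_integral_completion)
    also have "\<dots> = (\<integral>\<^sup>+x. ennreal ((curry z t x)\<^sup>2) * indicator \<Omega> x \<partial>lebesgue)"
      using elim(2) by (intro nn_integral_cong) (auto simp: y_def cylinder_def indicator_def)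
    also have "\<dots> = (\<integral>\<^sup>+x. ennreal ((curry z t x)\<^sup>2) \<partial>lebesgue_on \<Omega>)"
      using Q by (simp add: nn_integral_restrict_space)
    also have "\<dots> = ennreal (LINT x|lebesgue_on \<Omega>. (curry z t x)\<^sup>2)"
      using L2(1) by (intro nn_integral_eq_integral) (auto simp: lp_space_2_iff)
    also have "\<dots> \<le> ennreal (C * ?a\<^sup>2)"
      using L2(2) by (intro ennreal_leI) (simp add: C_def)
    also have "\<dots> \<le> ennreal (C * (1 + ?a powr r))"
    proof (intro ennreal_leI mult_left_mono C)
      show "?a\<^sup>2 \<le> 1 + ?a powr r"
      proof (cases "?a \<le> 1")
        case True
        then have "?a\<^sup>2 \<le> 1" by (intro power_le_one lp_norm_nonneg)
        then show ?thesis using powr_ge_zero[of ?a r] by linarith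
      next
        case False
        then have "?a powr 2 \<le> ?a powr r" using r by (intro powr_mono) auto
        then show ?thesis using False by simp
      qed
    qed
    finally show ?case .
  qed
  have "(\<integral>\<^sup>+q. ennreal ((y q)\<^sup>2) \<partial>lebesgue) = (\<integral>\<^sup>+q. ennreal ((y q)\<^sup>2) \<partial>lborel)"
    by (simp add: nn_integral_completion)
  also have "\<dots> = (\<integral>\<^sup>+q. ennreal ((g q)\<^sup>2) \<partial>(lborel \<Otimes>\<^sub>M lborel))"
    using g(2) unfolding lborel_prod by (intro nn_integral_cong_AE) (auto elim!: eventually_mono)
  also have "\<dots> = (\<integral>\<^sup>+t. \<integral>\<^sup>+x. ennreal ((g (t, x))\<^sup>2) \<partial>lborel \<partial>lborel)"
    using g(1) by (intro lborel.nn_integral_fst[symmetric]) (simp add: lborel_prod)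
  also have "\<dots> = (\<integral>\<^sup>+t. \<integral>\<^sup>+x. ennreal ((y (t, x))\<^sup>2) \<partial>lborel \<partial>lborel)"
    using slices by (intro nn_integral_cong_AE, eventually_elim)
      (auto intro!: nn_integral_cong_AE elim!: eventually_mono)
  also have "\<dots> = (\<integral>\<^sup>+t. \<integral>\<^sup>+x. ennreal ((y (t, x))\<^sup>2) \<partial>lborel \<partial>lebesgue)"
    by (simp add: nn_integral_completion)
  also have "\<dots> = (\<integral>\<^sup>+t. (\<integral>\<^sup>+x. ennreal ((y (t, x))\<^sup>2) \<partial>lborel) * indicator {0<..<T} t \<partial>lebesgue)"
    by (intro nn_integral_cong) (auto simp: y_def cylinder_def indicator_def)
  also have "\<dots> = (\<integral>\<^sup>+t. \<integral>\<^sup>+x. ennreal ((y (t, x))\<^sup>2) \<partial>lborel \<partial>?I)"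
    by (simp add: nn_integral_restrict_space)
  also have "\<dots> \<le> (\<integral>\<^sup>+t. ennreal (C * (1 + ?n (curry z t) powr r)) \<partial>?I)"
    by (rule nn_integral_mono_AE) (rule slice_bound)
  also have "\<dots> = ennreal (LINT t|?I. C * (1 + ?n (curry z t) powr r))"
    using C bochner_spaceD(2)[OF zb] by (intro nn_integral_eq_integral) auto
  also have "\<dots> < \<infinity>" by simp
  finally have "integrable lebesgue (\<lambda>q. (y q)\<^sup>2)"
    using ym by (intro integrableI_bounded) auto
  then have "integrable lebesgue (\<lambda>q. if q \<in> ?Q then (z q)\<^sup>2 else 0)"
    by (rule Bochner_Integration.integrable_cong[THEN iffD1, rotated -1]) (auto simp: y_def)
  then have "integrable (lebesgue_on ?Q) (\<lambda>q. (z q)\<^sup>2)"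
    by (rule Lebesgue_Measure.integrable_restrict_UNIV[OF Q(1), THEN iffD1])
  then show ?thesis using zm by (simp add: lp_space_2_iff)
qed

section \<open>Linearity of the state equation\<close>

context
  fixes s T :: real and \<Omega> :: "'a::euclidean_space set"
  assumes \<Omega>: "open \<Omega>" "bounded \<Omega>"
begin

interpretation H: function_seminorm "sobolev0 s \<Omega>" "sobolev_norm s"
  by (rule function_seminorm_sobolev0)

interpretation D: function_seminorm "sobolev_dual s \<Omega>" "dual_norm (sobolev0 s \<Omega>) (sobolev_norm s)"
  unfolding sobolev_dual_def by (rule H.function_seminorm_dual)

lemma sobolev0_L2: "v \<in> sobolev0 s \<Omega> \<Longrightarrow> v \<in> lp_space 2 (lebesgue_on \<Omega>)"
  using cylinder_lmeasurable(2)[OF \<Omega>]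
  by (auto simp: sobolev0_def sobolev_iff intro: lp_space_restrict fmeasurableD)

lemma pivot_lin:
  assumes "f \<in> lp_space 2 (lebesgue_on \<Omega>)" "g \<in> lp_space 2 (lebesgue_on \<Omega>)" "v \<in> sobolev0 s \<Omega>"
  shows "pivot \<Omega> (\<lambda>x. a * f x + b * g x) v = a * pivot \<Omega> f v + b * pivot \<Omega> g v"
  using integrable_mult_L2[OF assms(1) sobolev0_L2[OF assms(3)]]
    integrable_mult_L2[OF assms(2) sobolev0_L2[OF assms(3)]]
  by (simp add: pivot_def algebra_simps)

lemma L2_dual_lin:
  assumes "w1 \<in> L2_dual s T \<Omega>" "w2 \<in> L2_dual s T \<Omega>"
  shows "(\<lambda>t v. a * w1 t v + b * w2 t v) \<in> L2_dual s T \<Omega>"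
  using assms unfolding L2_dual_def by (intro D.bochner_space_lin) auto

lemma L2_dual_cong:
  assumes w: "w \<in> L2_dual s T \<Omega>"
    and eq: "AE t in lebesgue_on {0<..<T}. \<forall>v\<in>sobolev0 s \<Omega>. w' t v = w t v"
  shows "w' \<in> L2_dual s T \<Omega>"
  unfolding L2_dual_def
proof (rule D.bochner_space_cong)
  show "w \<in> bochner_space 2 T (sobolev_dual s \<Omega>) (dual_norm (sobolev0 s \<Omega>) (sobolev_norm s))"
    using w by (simp add: L2_dual_def)
  from D.bochner_spaceD(1)[OF this] eq
  show "AE t in lebesgue_on {0<..<T}. w' t \<in> sobolev_dual s \<Omega> \<and>
      dual_norm (sobolev0 s \<Omega>) (sobolev_norm s) (\<lambda>c. w t c - w' t c) = 0"
    by eventually_elim (use H.dual_space_cong in \<open>auto simp: sobolev_dual_def\<close>)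
qed

lemma integrable_L2_dual_eval:
  assumes "w \<in> L2_dual s T \<Omega>" "v \<in> sobolev0 s \<Omega>"
  shows "integrable (lebesgue_on {0<..<T}) (\<lambda>t. w t v)"
  using assms unfolding L2_dual_def sobolev_dual_def by (rule H.integrable_dual_eval)

text \<open>
  The derivative vanishes off the compact support as well, because a function vanishing on an
  open set has zero derivative there; so both functions are bounded.
\<close>

lemma test_function_bounded_continuous:
  assumes "\<phi> \<in> test_functions T"
  shows "continuous_on UNIV \<phi>" "bounded (range \<phi>)" "continuous_on UNIV (deriv \<phi>)" "bounded (range (deriv \<phi>))"
proof -
  have d: "(deriv ^^ k) \<phi> field_differentiable at t" for k t
    using assms by (auto simp: test_functions_def)
  obtain K where K: "compact K" "\<And>t. t \<notin> K \<Longrightarrow> \<phi> t = 0"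
    using assms by (auto simp: test_functions_def)
  show c: "continuous_on UNIV \<phi>" "continuous_on UNIV (deriv \<phi>)"
    using d[of 0] d[of 1] by (auto intro!: continuous_at_imp_continuous_on field_differentiable_imp_continuous_at)
  have dz: "deriv \<phi> t = 0" if "t \<notin> K" for t
  proof -
    have "open (- K)" using K by (simp add: compact_imp_closed open_Compl)
    then have "eventually (\<lambda>x. x \<in> - K) (nhds t)" using that by (intro eventually_nhds_in_open) auto
    then have "eventually (\<lambda>x. \<phi> x = 0) (nhds t)" by eventually_elim (use K in auto)
    then have "deriv \<phi> t = deriv (\<lambda>x. 0) t" by (intro deriv_cong_ev) auto
    then show ?thesis by simp
  qed
  have *: "bounded (range f)" if "continuous_on UNIV f" "\<And>t. t \<notin> K \<Longrightarrow> f t = 0" for f :: "real \<Rightarrow> real"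
  proof (rule bounded_subset)
    show "bounded (insert 0 (f ` K))"
      using K that by (auto intro!: compact_imp_bounded compact_continuous_image intro: continuous_on_subset)
  qed (use that in auto)
  show "bounded (range \<phi>)" "bounded (range (deriv \<phi>))"
    using * c K(2) dz by blast+
qed

lemma integrable_mult_bounded_continuous:
  fixes f g :: "real \<Rightarrow> real"
  assumes f: "continuous_on UNIV f" "bounded (range f)" and g: "integrable (lebesgue_on {0<..<T}) g"
  shows "integrable (lebesgue_on {0<..<T}) (\<lambda>t. f t * g t)"
proof -
  obtain B where B: "\<And>t. \<bar>f t\<bar> \<le> B" using f(2) by (auto simp: bounded_iff)
  have [measurable]: "f \<in> borel_measurable (lebesgue_on {0<..<T})"
    using f(1) by (intro measurable_restrict_space1 measurable_completion) (simp add: borel_measurable_continuous_onI)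
  note [measurable] = borel_measurable_integrable[OF g]
  show ?thesis
  proof (rule Bochner_Integration.integrable_bound)
    show "integrable (lebesgue_on {0<..<T}) (\<lambda>t. B * g t)" using g by simp
    have "\<bar>f t * g t\<bar> \<le> \<bar>B * g t\<bar>" for t
      using B[of t] by (simp add: abs_mult mult_right_mono)
    then show "AE t in lebesgue_on {0<..<T}. norm (f t * g t) \<le> norm (B * g t)" by simp
  qed measurable
qed

lemma weak_time_derivative_lin:
  assumes w: "w1 \<in> L2_dual s T \<Omega>" "w2 \<in> L2_dual s T \<Omega>" "w1' \<in> L2_dual s T \<Omega>" "w2' \<in> L2_dual s T \<Omega>"
    and wtd: "weak_time_derivative s T \<Omega> w1 w1'" "weak_time_derivative s T \<Omega> w2 w2'"
  shows "weak_time_derivative s T \<Omega> (\<lambda>t v. a * w1 t v + b * w2 t v) (\<lambda>t v. a * w1' t v + b * w2' t v)"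
  unfolding weak_time_derivative_def
proof (intro ballI)
  fix \<phi> v assume \<phi>: "\<phi> \<in> test_functions T" and v: "v \<in> sobolev0 s \<Omega>"
  note c = test_function_bounded_continuous[OF \<phi>]
  let ?I = "lebesgue_on {0<..<T}"
  have i: "integrable ?I (\<lambda>t. deriv \<phi> t * w t v)" "integrable ?I (\<lambda>t. \<phi> t * w t v)" if "w \<in> L2_dual s T \<Omega>" for w
    using that c v by (intro integrable_mult_bounded_continuous integrable_L2_dual_eval; simp)+
  have "(LINT t|?I. deriv \<phi> t * (a * w1 t v + b * w2 t v))
      = a * (LINT t|?I. deriv \<phi> t * w1 t v) + b * (LINT t|?I. deriv \<phi> t * w2 t v)"
    using i(1)[OF w(1)] i(1)[OF w(2)] by (simp add: distrib_left mult.left_commute)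
  also have "\<dots> = - (a * (LINT t|?I. \<phi> t * w1' t v) + b * (LINT t|?I. \<phi> t * w2' t v))"
    using wtd \<phi> v unfolding weak_time_derivative_def by simp
  also have "\<dots> = - (LINT t|?I. \<phi> t * (a * w1' t v + b * w2' t v))"
    using i(2)[OF w(3)] i(2)[OF w(4)] by (simp add: distrib_left mult.left_commute)
  finally show "(LINT t|?I. deriv \<phi> t * (a * w1 t v + b * w2 t v)) = - (LINT t|?I. \<phi> t * (a * w1' t v + b * w2' t v))" .
qed

lemma weak_time_derivative_cong:
  assumes w: "w \<in> L2_dual s T \<Omega>" and wtd: "weak_time_derivative s T \<Omega> w w'"
    and eq: "AE t in lebesgue_on {0<..<T}. \<forall>v\<in>sobolev0 s \<Omega>. W t v = w t v"
  shows "weak_time_derivative s T \<Omega> W w'"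
  unfolding weak_time_derivative_def
proof (intro ballI)
  fix \<phi> v assume \<phi>: "\<phi> \<in> test_functions T" and v: "v \<in> sobolev0 s \<Omega>"
  note c = test_function_bounded_continuous[OF \<phi>]
  let ?I = "lebesgue_on {0<..<T}"
  have i: "(\<lambda>t. deriv \<phi> t * w t v) \<in> borel_measurable ?I" if "w \<in> L2_dual s T \<Omega>" for w
    using that c v by (intro borel_measurable_integrable integrable_mult_bounded_continuous integrable_L2_dual_eval)
  have "(LINT t|?I. deriv \<phi> t * W t v) = (LINT t|?I. deriv \<phi> t * w t v)"
    using i[OF w] i[OF L2_dual_cong[OF w eq]] eq v by (intro integral_cong_AE) auto
  then show "(LINT t|?I. deriv \<phi> t * W t v) = - (LINT t|?I. \<phi> t * w' t v)"
    using wtd \<phi> v unfolding weak_time_derivative_def by simp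
qed

lemma U0_space_slice:
  assumes "u \<in> U0_space s T \<Omega>"
  shows "AE t in lebesgue_on {0<..<T}. curry u t \<in> sobolev0 s \<Omega>"
  using assms unfolding U0_space_def by (auto dest: H.bochner_spaceD)

text \<open>
  The exceptional set of times does not depend on the test function \<open>v\<close>: it is where the slices
  fail to be in the Sobolev space.
\<close>

lemma pivot_curry_lin_AE:
  assumes "u1 \<in> U0_space s T \<Omega>" "u2 \<in> U0_space s T \<Omega>"
  shows "AE t in lebesgue_on {0<..<T}. \<forall>v\<in>sobolev0 s \<Omega>.
    pivot \<Omega> (curry (\<lambda>q. a * u1 q + b * u2 q) t) v = a * pivot \<Omega> (curry u1 t) v + b * pivot \<Omega> (curry u2 t) v"
  using U0_space_slice[OF assms(1)] U0_space_slice[OF assms(2)]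
  by eventually_elim (simp add: curry_lin pivot_lin sobolev0_L2 del: curry_conv)

lemma U0_space_pivot_lin:
  assumes u: "u1 \<in> U0_space s T \<Omega>" "u2 \<in> U0_space s T \<Omega>"
    and w: "w1 \<in> L2_dual s T \<Omega>" "w2 \<in> L2_dual s T \<Omega>"
    and wtd: "weak_time_derivative s T \<Omega> (\<lambda>t. pivot \<Omega> (curry u1 t)) w1"
      "weak_time_derivative s T \<Omega> (\<lambda>t. pivot \<Omega> (curry u2 t)) w2"
  shows "weak_time_derivative s T \<Omega> (\<lambda>t. pivot \<Omega> (curry (\<lambda>q. a * u1 q + b * u2 q) t)) (\<lambda>t v. a * w1 t v + b * w2 t v)"
proof -
  have L: "(\<lambda>t. pivot \<Omega> (curry u1 t)) \<in> L2_dual s T \<Omega>" "(\<lambda>t. pivot \<Omega> (curry u2 t)) \<in> L2_dual s T \<Omega>"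
    using u by (auto simp: U0_space_def H1_dual_def)
  show ?thesis
    by (rule weak_time_derivative_cong[OF L2_dual_lin[OF L] weak_time_derivative_lin[OF L w wtd] pivot_curry_lin_AE[OF u]])
qed

lemma U0_space_lin:
  assumes u: "u1 \<in> U0_space s T \<Omega>" "u2 \<in> U0_space s T \<Omega>"
  shows "(\<lambda>q. a * u1 q + b * u2 q) \<in> U0_space s T \<Omega>"
proof -
  have L: "(\<lambda>t. pivot \<Omega> (curry u1 t)) \<in> L2_dual s T \<Omega>" "(\<lambda>t. pivot \<Omega> (curry u2 t)) \<in> L2_dual s T \<Omega>"
    using u by (auto simp: U0_space_def H1_dual_def)
  obtain w1 w2 where w: "w1 \<in> L2_dual s T \<Omega>" "w2 \<in> L2_dual s T \<Omega>"
    "weak_time_derivative s T \<Omega> (\<lambda>t. pivot \<Omega> (curry u1 t)) w1"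
    "weak_time_derivative s T \<Omega> (\<lambda>t. pivot \<Omega> (curry u2 t)) w2"
    using u by (auto simp: U0_space_def H1_dual_def)
  have "(\<lambda>t. pivot \<Omega> (curry (\<lambda>q. a * u1 q + b * u2 q) t)) \<in> H1_dual s T \<Omega>"
    unfolding H1_dual_def using U0_space_pivot_lin[OF u w] L2_dual_lin[OF w(1,2)]
      L2_dual_cong[OF L2_dual_lin[OF L] pivot_curry_lin_AE[OF u]] by blast
  moreover have "curry (\<lambda>q. a * u1 q + b * u2 q) \<in> bochner_space 2 T (sobolev0 s \<Omega>) (sobolev_norm s)"
    unfolding curry_lin using u by (intro H.bochner_space_lin) (auto simp: U0_space_def simp del: curry_conv)
  ultimately show ?thesis by (simp add: U0_space_def)
qed

text \<open>
  Superposition: the weak derivatives, the energy form and the right-hand sides all combine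
  linearly at almost every time, where the slices lie in the spaces on which they are linear.
\<close>

lemma parabolic_eq_lin:
  assumes u: "u1 \<in> U0_space s T \<Omega>" "u2 \<in> U0_space s T \<Omega>"
    and p: "2 \<le> p" and f: "f1 \<in> LrLp r p T \<Omega>" "f2 \<in> LrLp r p T \<Omega>"
    and eq: "parabolic_eq s T \<Omega> u1 f1" "parabolic_eq s T \<Omega> u2 f2"
  shows "parabolic_eq s T \<Omega> (\<lambda>q. a * u1 q + b * u2 q) (\<lambda>q. a * f1 q + b * f2 q)"
proof -
  let ?I = "lebesgue_on {0<..<T}"
  obtain w1 where w1: "w1 \<in> L2_dual s T \<Omega>" "weak_time_derivative s T \<Omega> (\<lambda>t. pivot \<Omega> (curry u1 t)) w1"
    "\<And>v. v \<in> sobolev0 s \<Omega> \<Longrightarrow> AE t in ?I. w1 t v + energy s (curry u1 t) v = pivot \<Omega> (curry f1 t) v"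
    using eq(1) unfolding parabolic_eq_def by blast
  obtain w2 where w2: "w2 \<in> L2_dual s T \<Omega>" "weak_time_derivative s T \<Omega> (\<lambda>t. pivot \<Omega> (curry u2 t)) w2"
    "\<And>v. v \<in> sobolev0 s \<Omega> \<Longrightarrow> AE t in ?I. w2 t v + energy s (curry u2 t) v = pivot \<Omega> (curry f2 t) v"
    using eq(2) unfolding parabolic_eq_def by blast
  have "AE t in ?I. (a * w1 t v + b * w2 t v) + energy s (curry (\<lambda>q. a * u1 q + b * u2 q) t) v
      = pivot \<Omega> (curry (\<lambda>q. a * f1 q + b * f2 q) t) v" if v: "v \<in> sobolev0 s \<Omega>" for v
    using w1(3)[OF v] w2(3)[OF v] U0_space_slice[OF u(1)] U0_space_slice[OF u(2)]
      LrLp_slice_L2[OF \<Omega> p f(1)] LrLp_slice_L2[OF \<Omega> p f(2)]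
  proof eventually_elim
    case (elim t)
    have "energy s (curry (\<lambda>q. a * u1 q + b * u2 q) t) v = a * energy s (curry u1 t) v + b * energy s (curry u2 t) v"
      unfolding curry_lin using elim v by (intro energy_lin) (auto simp: sobolev0_def simp del: curry_conv)
    moreover have "pivot \<Omega> (curry (\<lambda>q. a * f1 q + b * f2 q) t) v = a * pivot \<Omega> (curry f1 t) v + b * pivot \<Omega> (curry f2 t) v"
      unfolding curry_lin using elim v by (intro pivot_lin) (auto simp del: curry_conv)
    ultimately show ?case
      by (simp flip: elim(1,2) add: algebra_simps)
  qed
  then show ?thesis
    unfolding parabolic_eq_def
    using L2_dual_lin[OF w1(1) w2(1)] U0_space_pivot_lin[OF u w1(1) w2(1) w1(2) w2(2)] by blast
qed

lemma state_equation_lin: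
  assumes "2 \<le> p" "f1 \<in> LrLp r p T \<Omega>" "f2 \<in> LrLp r p T \<Omega>"
    and eq: "state_equation s T \<Omega> u1 f1" "state_equation s T \<Omega> u2 f2"
  shows "state_equation s T \<Omega> (\<lambda>q. a * u1 q + b * u2 q) (\<lambda>q. a * f1 q + b * f2 q)"
proof -
  have "initial_zero \<Omega> (\<lambda>q. a * u1 q + b * u2 q)"
    using eq unfolding state_equation_def initial_zero_def by (auto elim!: eventually_elim2)
  then show ?thesis
    using assms by (auto simp: state_equation_def intro!: U0_space_lin parabolic_eq_lin)
qed

end

section \<open>Integration against a nonnegative Radon measure\<close>

lemma radon_measure_additive:
  assumes \<mu>: "\<mu> \<in> radon_measures K"
    and A: "A \<in> sets (restrict_space borel K)" and B: "B \<in> sets (restrict_space borel K)" "A \<inter> B = {}"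
  shows "\<mu> {} = 0" "\<mu> (A \<union> B) = \<mu> A + \<mu> B"
proof -
  have sums: "(\<lambda>i. \<mu> (F i)) sums \<mu> (\<Union>i. F i)" 
    if "range F \<subseteq> sets (restrict_space borel K)" "disjoint_family F" for F
    using \<mu> that unfolding radon_measures_def by blast
  have "(\<lambda>i::nat. \<mu> {}) sums \<mu> {}"
    using sums[of "\<lambda>_. {}"] by (simp add: disjoint_family_on_def)
  then show 0: "\<mu> {} = 0"
    using sums_summable summable_const_iff by blast
  have "disjoint_family (binaryset A B)"
    using B(2) by (auto simp: disjoint_family_on_def binaryset_def)
  then have "(\<lambda>i. \<mu> (binaryset A B i)) sums \<mu> (A \<union> B)"
    using sums[of "binaryset A B"] A B(1) by (simp add: UN_binaryset_eq range_binaryset_eq)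
  then show "\<mu> (A \<union> B) = \<mu> A + \<mu> B"
    using binaryset_sums[of \<mu>, OF 0] sums_unique2 by blast
qed

text \<open>
  For a nonnegative set function the supremum defining the positive part is attained by the set
  itself, by monotonicity, and the negative part vanishes. Hence the integral against \<open>\<mu>\<close> is an
  ordinary Lebesgue integral.
\<close>

lemma
  assumes \<mu>: "\<mu> \<in> radon_measures K" and pos: "\<forall>B\<in>sets (restrict_space borel K). 0 \<le> \<mu> B"
  shows sets_positive_variation: "sets (positive_variation K \<mu>) = sets (restrict_space borel K)"
    and emeasure_positive_variation:
      "A \<in> sets (restrict_space borel K) \<Longrightarrow> emeasure (positive_variation K \<mu>) A = ennreal (\<mu> A)"
    and radon_integral_nonneg_measure:
      "radon_integral K \<mu> A v = (LINT q:A|positive_variation K \<mu>. v q)"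
proof -
  let ?S = "sets (restrict_space borel K)"
  have S: "?S \<subseteq> Pow K" 
    by (auto simp: sets_restrict_space)
  have sig: "sigma_sets K ?S = ?S"
    using sets.sigma_sets_eq[of "restrict_space borel K"] by (simp add: space_restrict_space)
  note add = radon_measure_additive[OF \<mu>]
  have mono: "\<mu> B \<le> \<mu> A" if "A \<in> ?S" "B \<in> ?S" "B \<subseteq> A" for A B
  proof -
    have "A - B \<in> ?S" using that by blast
    then have "\<mu> (B \<union> (A - B)) = \<mu> B + \<mu> (A - B)" using that by (intro add) auto
    moreover have "B \<union> (A - B) = A" using that by auto
    ultimately show ?thesis using pos \<open>A - B \<in> ?S\<close> by fastforce
  qed
  have sup: "(SUP B\<in>{B \<in> ?S. B \<subseteq> A}. ennreal (\<mu> B)) = ennreal (\<mu> A)" if "A \<in> ?S" for A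
    using that by (intro antisym SUP_least SUP_upper) (auto intro!: ennreal_leI mono)
  let ?M = "positive_variation K \<mu>"
  show sets: "sets ?M = ?S"
    by (simp add: positive_variation_def S sig)
  show "emeasure ?M A = ennreal (\<mu> A)" if A: "A \<in> ?S" for A
  proof -
    have "countably_additive ?S (\<lambda>A. SUP B\<in>{B \<in> ?S. B \<subseteq> A}. ennreal (\<mu> B))"
    proof (rule countably_additiveI)
      fix F :: "nat \<Rightarrow> _" assume F: "range F \<subseteq> ?S" "disjoint_family F" "(\<Union>i. F i) \<in> ?S"
      have "(\<lambda>i. \<mu> (F i)) sums \<mu> (\<Union>i. F i)"
        using \<mu> F unfolding radon_measures_def by blast
      then have "(\<Sum>i. ennreal (\<mu> (F i))) = ennreal (\<mu> (\<Union>i. F i))"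
        using F pos by (intro suminf_ennreal_eq) auto
      then show "(\<Sum>i. SUP B\<in>{B \<in> ?S. B \<subseteq> F i}. ennreal (\<mu> B)) = (SUP B\<in>{B \<in> ?S. B \<subseteq> (\<Union>i. F i)}. ennreal (\<mu> B))"
        using F sup by (simp add: range_subsetD)
    qed
    moreover have "positive ?S (\<lambda>A. SUP B\<in>{B \<in> ?S. B \<subseteq> A}. ennreal (\<mu> B))"
      using sup[of "{}"] add(1)[OF A, of "{}"] by (simp add: positive_def)
    ultimately show ?thesis
      using A sup[OF A] S sets
      by (subst emeasure_measure_of[OF positive_variation_def]) (auto simp: sets)
  qed
  let ?N = "positive_variation K (\<lambda>B. - \<mu> B)"
  have sup0: "(SUP B\<in>{B \<in> ?S. B \<subseteq> A}. ennreal (- \<mu> B)) = 0" if "A \<in> ?S" for A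
    using pos by (auto simp: ennreal_neg intro!: antisym SUP_least)
  have setsN: "sets ?N = ?S"
    by (simp add: positive_variation_def S sig)
  have K: "K \<in> ?S" using sets.top[of "restrict_space borel K"] by (simp add: space_restrict_space)
  have "countably_additive ?S (\<lambda>A. SUP B\<in>{B \<in> ?S. B \<subseteq> A}. ennreal (- \<mu> B))"
    by (rule countably_additiveI) (simp add: sup0 range_subsetD)
  moreover have "positive ?S (\<lambda>A. SUP B\<in>{B \<in> ?S. B \<subseteq> A}. ennreal (- \<mu> B))"
    using sup0[of "{}"] by (simp add: positive_def)
  ultimately have "emeasure ?N K = 0"
    using K sup0[OF K] S setsN
    by (subst emeasure_measure_of[OF positive_variation_def]) (auto simp: setsN)
  moreover have "space ?N = K" by (simp add: positive_variation_def S)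
  ultimately have "space ?N \<in> null_sets ?N" by (auto simp: null_sets_def setsN K)
  then have ae: "AE q in ?N. P q" for P
    by (rule AE_I') auto
  have "(LINT q:A|?N. v q) = 0"
    unfolding set_lebesgue_integral_def by (rule integral_eq_zero_AE) (rule ae)
  then show "radon_integral K \<mu> A v = (LINT q:A|?M. v q)"
    by (simp add: radon_integral_def)
qed

context
  fixes K :: "'b::euclidean_space set" and \<mu> :: "'b set \<Rightarrow> real"
  assumes K: "compact K" and \<mu>: "\<mu> \<in> radon_measures K"
    and pos: "\<forall>B\<in>sets (restrict_space borel K). 0 \<le> \<mu> B"
begin

lemma integrable_positive_variation:
  fixes v :: "'b \<Rightarrow> real"
  assumes v: "continuous_on K v" and A: "A \<in> sets (restrict_space borel K)"
  shows "set_integrable (positive_variation K \<mu>) A v"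
proof -
  let ?M = "positive_variation K \<mu>"
  note sets = sets_positive_variation[OF \<mu> pos]
  have space: "space ?M = K" using sets_eq_imp_space_eq[OF sets] by (simp add: space_restrict_space)
  have KS: "K \<in> sets (restrict_space borel K)"
    using sets.top[of "restrict_space borel K"] by (simp add: space_restrict_space)
  interpret finite_measure ?M
    by (rule finite_measureI) (simp add: space emeasure_positive_variation[OF \<mu> pos KS])
  have "v \<in> borel_measurable (restrict_space borel K)"
    using v by (rule borel_measurable_continuous_on_restrict)
  then have "v \<in> borel_measurable ?M"
    by (simp add: measurable_cong_sets[OF sets refl])
  moreover obtain C where "\<And>q. q \<in> K \<Longrightarrow> norm (v q) \<le> C"
    using compact_imp_bounded[OF compact_continuous_image[OF v K]] by (auto simp: bounded_iff)
  ultimately have "integrable ?M v"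
    using space by (intro integrable_const_bound[of _ C]) auto
  then show ?thesis
    unfolding set_integrable_def using A sets by (intro integrable_mult_indicator) auto
qed

lemma radon_integral_lin:
  assumes "continuous_on K v" "continuous_on K w" "A \<in> sets (restrict_space borel K)"
  shows "radon_integral K \<mu> A (\<lambda>q. a * v q + b * w q) = a * radon_integral K \<mu> A v + b * radon_integral K \<mu> A w"
  unfolding radon_integral_nonneg_measure[OF \<mu> pos]
  using integrable_positive_variation[OF assms(1,3)] integrable_positive_variation[OF assms(2,3)]
  by (simp add: set_integral_add(2))

lemma radon_integral_mono:
  assumes "continuous_on K v" "continuous_on K w" "A \<in> sets (restrict_space borel K)"
    and "\<And>q. q \<in> A \<Longrightarrow> v q \<le> w q"
  shows "radon_integral K \<mu> A v \<le> radon_integral K \<mu> A w"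
  unfolding radon_integral_nonneg_measure[OF \<mu> pos]
  using integrable_positive_variation[OF assms(1,3)] integrable_positive_variation[OF assms(2,3)] assms(4)
  by (rule set_integral_mono)

text \<open>
  The adjoint equation sees the multiplier only on the open cylinder and at the final time. The
  vanishing of the restrictions to the initial time and the lateral boundary is what makes these
  two parts add up to the whole integral.
\<close>

lemma radon_integral_split:
  assumes v: "continuous_on K v"
    and A: "A \<in> sets (restrict_space borel K)" and B: "B \<in> sets (restrict_space borel K)" "A \<inter> B = {}"
    and null: "zero_restriction K \<mu> N1" "zero_restriction K \<mu> N2"
      "N1 \<in> sets (restrict_space borel K)" "N2 \<in> sets (restrict_space borel K)"
    and cover: "K \<subseteq> A \<union> B \<union> N1 \<union> N2"
  shows "radon_integral K \<mu> K v = radon_integral K \<mu> A v + radon_integral K \<mu> B v"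
proof -
  let ?M = "positive_variation K \<mu>"
  note sets = sets_positive_variation[OF \<mu> pos]
  have space: "space ?M = K" using sets_eq_imp_space_eq[OF sets] by (simp add: space_restrict_space)
  have "N1 \<in> null_sets ?M" "N2 \<in> null_sets ?M"
    using null sets by (auto simp: null_sets_def zero_restriction_def emeasure_positive_variation[OF \<mu> pos])
  then have ae: "AE q in ?M. q \<notin> N1 \<and> q \<notin> N2"
    using AE_not_in by auto
  have AB: "A \<union> B \<subseteq> K" using A B by (auto simp: sets_restrict_space)
  have "(LINT q:K|?M. v q) = (LINT q:A \<union> B|?M. v q)"
  proof (rule set_integral_cong_set)
    have "set_borel_measurable ?M C v" if "C \<in> sets (restrict_space borel K)" for C
      using integrable_positive_variation[OF v that]
      unfolding set_integrable_def set_borel_measurable_def by (rule borel_measurable_integrable)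
    then show "set_borel_measurable ?M (A \<union> B) v" "set_borel_measurable ?M K v"
      using A B(1) sets.top[of ?M] space sets by auto
    show "AE q in ?M. q \<in> A \<union> B \<longleftrightarrow> q \<in> K"
      using ae by eventually_elim (use cover AB in auto)
  qed
  also have "\<dots> = (LINT q:A|?M. v q) + (LINT q:B|?M. v q)"
    using integrable_positive_variation[OF v A] integrable_positive_variation[OF v B(1)] B(2)
    by (intro set_integral_Un) auto
  finally show ?thesis
    by (simp add: radon_integral_nonneg_measure[OF \<mu> pos])
qed

end

section \<open>The penalised cost functional\<close>

text \<open>
  The key inequality of the estimate. Since $u \le 0$, it suffices to bound $-(m + \gamma v)_+ v$.
  For $v \ge 0$ this is $-mv - \gamma v^2 \le -\gamma v^2$; for $v < 0$ it is nonzero only if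
  $|v| < m/\gamma$, and then both factors are bounded, by $m$ and $m/\gamma$.
\<close>

lemma penalty_pointwise:
  fixes m u v \<gamma> :: real
  assumes "0 < \<gamma>" "0 \<le> m" "u \<le> 0"
  shows "max 0 (m + \<gamma> * v) * (u - v) \<le> 1 / \<gamma> * m\<^sup>2 - \<gamma> * (max 0 v)\<^sup>2"
proof -
  have 1: "max 0 (m + \<gamma> * v) * (u - v) \<le> max 0 (m + \<gamma> * v) * (- v)"
    using assms by (intro mult_left_mono) auto
  have 2: "max 0 (m + \<gamma> * v) * (- v) \<le> 1 / \<gamma> * m\<^sup>2 - \<gamma> * (max 0 v)\<^sup>2"
  proof (cases "0 \<le> v")
    case True
    then have "max 0 (m + \<gamma> * v) * (- v) = - (m * v) - \<gamma> * v\<^sup>2"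
      using assms by (simp add: max_def algebra_simps power2_eq_square)
    also have "\<dots> \<le> 0 - \<gamma> * v\<^sup>2" using True assms by simp
    also have "\<dots> \<le> 1 / \<gamma> * m\<^sup>2 - \<gamma> * v\<^sup>2" using assms by simp
    finally show ?thesis using True by (simp add: max_def)
  next
    case False
    have "max 0 (m + \<gamma> * v) * (- v) \<le> m * (m / \<gamma>)"
    proof (cases "m + \<gamma> * v \<le> 0")
      case True
      then show ?thesis using assms by simp
    next
      case pos: False
      have "m + \<gamma> * v \<le> m" using False assms by (simp add: mult_nonneg_nonpos)
      moreover have "- v \<le> m / \<gamma>" using pos assms by (simp add: pos_le_divide_eq algebra_simps)
      ultimately show ?thesis using pos False assms by (intro mult_mono) auto
    qed
    then show ?thesis using False by (simp add: power2_eq_square)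
  qed
  from 1 2 show ?thesis by (rule order_trans)
qed

text \<open>
  A quadratic upper bound replaces the differentiability of the squared positive part, so that
  the directional derivative of the cost is obtained without differentiating under the integral.
\<close>

lemma max0_add_power2_le:
  fixes a h :: real
  shows "(max 0 (a + h))\<^sup>2 \<le> (max 0 a)\<^sup>2 + 2 * (max 0 a * h) + h\<^sup>2"
proof -
  have "max 0 (a + h) \<le> \<bar>max 0 a + h\<bar>" by auto
  then have "(max 0 (a + h))\<^sup>2 \<le> \<bar>max 0 a + h\<bar>\<^sup>2" by (intro power_mono) auto
  then show ?thesis by (simp add: power2_sum)
qed

lemma nonneg_if_quadratic_nonneg:
  fixes A B :: real
  assumes "\<And>\<tau>. 0 < \<tau> \<Longrightarrow> \<tau> \<le> 1 \<Longrightarrow> 0 \<le> \<tau> * A + \<tau>\<^sup>2 * B"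
  shows "0 \<le> A"
proof (rule tendsto_lowerbound)
  have "((\<lambda>\<tau>. A + \<tau> * B) \<longlongrightarrow> A + 0 * B) (at_right 0)"
    by (intro tendsto_intros)
  then show "((\<lambda>\<tau>. A + \<tau> * B) \<longlongrightarrow> A) (at_right 0)" by simp
  have "0 \<le> A + \<tau> * B" if "0 < \<tau>" "\<tau> < 1" for \<tau>
  proof -
    have "0 \<le> \<tau> * (A + \<tau> * B)" using assms[of \<tau>] that by (simp add: algebra_simps power2_eq_square)
    then show ?thesis using that by (simp add: zero_le_mult_iff)
  qed
  then show "\<forall>\<^sub>F \<tau> in at_right 0. 0 \<le> A + \<tau> * B"
    by (intro eventually_at_rightI[of 0 1]) auto
qed simp

lemma lp_space_2_max0:
  assumes "f \<in> lp_space 2 M"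
  shows "(\<lambda>x. max 0 (f x)) \<in> lp_space 2 M"
proof -
  have [measurable]: "f \<in> borel_measurable M" and int: "integrable M (\<lambda>x. (f x)\<^sup>2)"
    using assms by (auto simp: lp_space_2_iff)
  have "integrable M (\<lambda>x. (max 0 (f x))\<^sup>2)"
    by (rule Bochner_Integration.integrable_bound[OF int]) (auto simp: max_def)
  then show ?thesis by (simp add: lp_space_2_iff)
qed

lemma integral_power2_add_scaled:
  assumes "f \<in> lp_space 2 M" "h \<in> lp_space 2 M"
  shows "(LINT q|M. (f q + c * h q)\<^sup>2) = (LINT q|M. (f q)\<^sup>2) + 2 * c * (LINT q|M. f q * h q) + c\<^sup>2 * (LINT q|M. (h q)\<^sup>2)"
proof -
  have "(\<lambda>q. (f q + c * h q)\<^sup>2) = (\<lambda>q. (f q)\<^sup>2 + (2 * c) * (f q * h q) + c\<^sup>2 * (h q)\<^sup>2)"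
    by (auto simp: power2_eq_square algebra_simps)
  then show ?thesis
    using assms integrable_mult_L2[OF assms] by (simp add: lp_space_2_iff)
qed

lemma integral_max0_power2_add_scaled_le:
  assumes f: "f \<in> lp_space 2 M" and h: "h \<in> lp_space 2 M"
  shows "(LINT q|M. (max 0 (f q + c * h q))\<^sup>2)
    \<le> (LINT q|M. (max 0 (f q))\<^sup>2) + 2 * c * (LINT q|M. max 0 (f q) * h q) + c\<^sup>2 * (LINT q|M. (h q)\<^sup>2)"
proof -
  have fh: "(\<lambda>q. f q + c * h q) \<in> lp_space 2 M"
    using lp_space_lin[OF _ f h, of 1 c] by simp
  have int: "integrable M (\<lambda>q. max 0 (f q) * h q)" "integrable M (\<lambda>q. (max 0 (f q))\<^sup>2)" "integrable M (\<lambda>q. (h q)\<^sup>2)"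
    "integrable M (\<lambda>q. (max 0 (f q + c * h q))\<^sup>2)"
    using integrable_mult_L2[OF lp_space_2_max0[OF f] h] lp_space_2_max0[OF f] lp_space_2_max0[OF fh] h
    by (auto simp: lp_space_2_iff)
  have "(LINT q|M. (max 0 (f q + c * h q))\<^sup>2) \<le> (LINT q|M. (max 0 (f q))\<^sup>2 + (2 * c) * (max 0 (f q) * h q) + c\<^sup>2 * (h q)\<^sup>2)"
    using int max0_add_power2_le[of "f q" "c * h q" for q]
    by (intro integral_mono) (auto simp: power_mult_distrib mult.left_commute mult.assoc)
  then show ?thesis using int by simp
qed

lemma L2Q_norm_power2: "(L2Q_norm T \<Omega> f)\<^sup>2 = (LINT q|lebesgue_on (cylinder T \<Omega>). (f q)\<^sup>2)"
  by (simp add: L2Q_norm_def lp_norm_2_power2)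

text \<open>
  Along the segment in direction \<open>(h, k)\<close> the cost increases by at most \<open>\<tau> * A + \<tau>\<^sup>2 * B\<close>, where
  \<open>A\<close> is the directional derivative; if no point of the segment is better than its start, then
  \<open>A\<close> is nonnegative.
\<close>

lemma regularized_variational_inequality:
  fixes T :: real and \<Omega> :: "'a::euclidean_space set"
  defines "M \<equiv> lebesgue_on (cylinder T \<Omega>)"
  assumes L2: "u \<in> lp_space 2 M" "ud \<in> lp_space 2 M" "z \<in> lp_space 2 M" "m \<in> lp_space 2 M"
      "h \<in> lp_space 2 M" "k \<in> lp_space 2 M"
    and \<gamma>: "0 < \<gamma>"
    and min: "\<And>\<tau>. 0 < \<tau> \<Longrightarrow> \<tau> \<le> 1 \<Longrightarrow>
      cost_reg T \<Omega> ud \<alpha> m \<gamma> u z \<le> cost_reg T \<Omega> ud \<alpha> m \<gamma> (\<lambda>q. u q + \<tau> * h q) (\<lambda>q. z q + \<tau> * k q)"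
  shows "0 \<le> (LINT q|M. (u q - ud q) * h q) + \<alpha> * (LINT q|M. z q * k q)
    + (LINT q|M. max 0 (m q + \<gamma> * u q) * h q)" (is "0 \<le> ?A")
proof (rule nonneg_if_quadratic_nonneg)
  fix \<tau> :: real assume \<tau>: "0 < \<tau>" "\<tau> \<le> 1"
  let ?H = "LINT q|M. (h q)\<^sup>2" and ?K = "LINT q|M. (k q)\<^sup>2"
  let ?P = "LINT q|M. max 0 (m q + \<gamma> * u q) * h q"
  have e: "(\<lambda>q. u q - ud q) \<in> lp_space 2 M"
    using lp_space_lin[OF _ L2(1,2), of 1 "-1"] by simp
  have a: "(\<lambda>q. m q + \<gamma> * u q) \<in> lp_space 2 M"
    using lp_space_lin[OF _ L2(4,1), of 1 \<gamma>] by simp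
  have tracking: "(LINT q|M. (u q + \<tau> * h q - ud q)\<^sup>2)
      = (LINT q|M. (u q - ud q)\<^sup>2) + 2 * \<tau> * (LINT q|M. (u q - ud q) * h q) + \<tau>\<^sup>2 * ?H"
    using integral_power2_add_scaled[OF e L2(5), of \<tau>] by (simp add: algebra_simps)
  have control: "(LINT q|M. (z q + \<tau> * k q)\<^sup>2)
      = (LINT q|M. (z q)\<^sup>2) + 2 * \<tau> * (LINT q|M. z q * k q) + \<tau>\<^sup>2 * ?K"
    using integral_power2_add_scaled[OF L2(3,6), of \<tau>] .
  have "(LINT q|M. (max 0 (m q + \<gamma> * (u q + \<tau> * h q)))\<^sup>2)
      \<le> (LINT q|M. (max 0 (m q + \<gamma> * u q))\<^sup>2) + 2 * (\<tau> * \<gamma>) * ?P + (\<tau> * \<gamma>)\<^sup>2 * ?H"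
    using integral_max0_power2_add_scaled_le[OF a L2(5), of "\<tau> * \<gamma>"] by (simp add: algebra_simps)
  then have "1 / (2 * \<gamma>) * (LINT q|M. (max 0 (m q + \<gamma> * (u q + \<tau> * h q)))\<^sup>2)
      \<le> 1 / (2 * \<gamma>) * ((LINT q|M. (max 0 (m q + \<gamma> * u q))\<^sup>2) + 2 * (\<tau> * \<gamma>) * ?P + (\<tau> * \<gamma>)\<^sup>2 * ?H)"
    using \<gamma> by (intro mult_left_mono) auto
  also have "\<dots> = 1 / (2 * \<gamma>) * (LINT q|M. (max 0 (m q + \<gamma> * u q))\<^sup>2) + \<tau> * ?P + \<tau>\<^sup>2 * (\<gamma> / 2 * ?H)"
    using \<gamma> by (simp add: distrib_left power2_eq_square)
  finally have penalty: "1 / (2 * \<gamma>) * (LINT q|M. (max 0 (m q + \<gamma> * (u q + \<tau> * h q)))\<^sup>2)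
      \<le> 1 / (2 * \<gamma>) * (LINT q|M. (max 0 (m q + \<gamma> * u q))\<^sup>2) + \<tau> * ?P + \<tau>\<^sup>2 * (\<gamma> / 2 * ?H)" .
  from min[OF \<tau>] penalty show "0 \<le> \<tau> * ?A + \<tau>\<^sup>2 * (1 / 2 * ?H + \<alpha> / 2 * ?K + \<gamma> / 2 * ?H)"
    unfolding cost_reg_def cost_def L2Q_norm_power2 M_def[symmetric] tracking control
    by (simp add: algebra_simps)
qed

section \<open>First order conditions and the error estimate\<close>

lemma closure_cylinder:
  assumes "0 < T"
  shows "closure (cylinder T \<Omega>) = {0..T} \<times> closure \<Omega>"
  using assms by (simp add: cylinder_def closure_Times)

lemma continuous_on_closure_cylinder_L2:
  assumes "open \<Omega>" "bounded \<Omega>" "continuous_on (closure (cylinder T \<Omega>)) v"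
  shows "v \<in> lp_space 2 (lebesgue_on (cylinder T \<Omega>))"
proof -
  let ?Q = "cylinder T \<Omega>"
  have Q: "?Q \<in> lmeasurable" using assms by (intro cylinder_lmeasurable)
  interpret finite_measure "lebesgue_on ?Q" using Q by (rule finite_measure_lebesgue_on)
  have "bounded ?Q" using assms by (auto simp: cylinder_def intro: bounded_Times)
  then have "compact (closure ?Q)" by simp
  then obtain C where C: "\<And>q. q \<in> closure ?Q \<Longrightarrow> norm (v q) \<le> C"
    using compact_imp_bounded[OF compact_continuous_image[OF assms(3)]] by (auto simp: bounded_iff)
  have "continuous_on ?Q v" using assms(3) closure_subset by (rule continuous_on_subset)
  then have [measurable]: "v \<in> borel_measurable (lebesgue_on ?Q)"
    using Q by (intro continuous_imp_measurable_on_sets_lebesgue fmeasurableD)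
  have "(v q)\<^sup>2 \<le> C\<^sup>2" if "q \<in> ?Q" for q
    using C[of q] that closure_subset[of ?Q] by (auto intro!: power2_le_iff_abs_le[THEN iffD2] intro: order_trans[OF abs_ge_zero])
  then have "integrable (lebesgue_on ?Q) (\<lambda>q. (v q)\<^sup>2)"
    by (intro integrable_const_bound[where B = "C\<^sup>2"]) auto
  then show ?thesis by (simp add: lp_space_2_iff)
qed

text \<open>
  Test the adjoint equation with the difference of two states, whose right-hand side is the
  difference of the controls, and insert the result into the variational inequality for the
  adjoint state. By complementarity the integral of \<open>u\<close> against the multiplier drops out.
\<close>

lemma multiplier_inequality:
  fixes \<Omega> :: "'a::euclidean_space set"
  assumes \<Omega>: "open \<Omega>" "bounded \<Omega>" and T: "0 < T" and p: "2 \<le> p" and r: "2 \<le> r"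
    and u: "u \<in> U_space s r p T \<Omega>" "state_equation s T \<Omega> u z" "z \<in> LrLp r p T \<Omega>"
    and v: "v \<in> U_space s r p T \<Omega>" "state_equation s T \<Omega> v y" "y \<in> LrLp r p T \<Omega>" "y \<in> Zad"
    and multiplier: "lagrange_multiplier s r p T \<Omega> Zad ud \<alpha> u z \<mu>"
  defines "K \<equiv> closure (cylinder T \<Omega>)" and "M \<equiv> lebesgue_on (cylinder T \<Omega>)"
  shows "0 \<le> (LINT q|M. (u q - ud q) * (v q - u q)) + \<alpha> * (LINT q|M. z q * (y q - z q)) + radon_integral K \<mu> K v"
proof -
  let ?Q = "cylinder T \<Omega>" and ?S = "sets (restrict_space borel K)"
  have \<mu>: "\<mu> \<in> radon_measures K" and pos: "\<forall>B\<in>?S. 0 \<le> \<mu> B"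
    and compl: "radon_integral K \<mu> K u = 0"
    using multiplier by (auto simp: lagrange_multiplier_def Let_def K_def)
  obtain \<xi> where adj: "adjoint_equation s r p T \<Omega> ud u \<mu> \<xi>"
    and vi: "\<And>\<zeta>. \<zeta> \<in> Zad \<Longrightarrow> 0 \<le> \<xi> (\<lambda>q. \<zeta> q - z q) + \<alpha> * (LINT q|M. z q * (\<zeta> q - z q))"
    using multiplier unfolding lagrange_multiplier_def Let_def M_def by blast
  have "bounded ?Q" using \<Omega> by (auto simp: cylinder_def intro: bounded_Times)
  then have K: "compact K" by (simp add: K_def)
  have Keq: "K = {0..T} \<times> closure \<Omega>" using T by (simp add: K_def closure_cylinder)
  have in_S: "B \<in> ?S" if "B \<in> sets borel" "B \<subseteq> K" for B
    using that by (auto simp: sets_restrict_space)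
  have QS: "?Q \<in> ?S"
  proof (rule in_S)
    show "?Q \<in> sets borel" using \<Omega>(1) unfolding cylinder_def by (intro borel_open open_Times) auto
    show "?Q \<subseteq> K" unfolding K_def by (rule closure_subset)
  qed
  have TS: "{T} \<times> closure \<Omega> \<in> ?S"
    by (intro in_S borel_closed closed_Times) (use T in \<open>auto simp: Keq\<close>)
  have 0: "{0} \<times> closure \<Omega> \<in> ?S"
    by (intro in_S borel_closed closed_Times) (use T in \<open>auto simp: Keq\<close>)
  have FS: "{0<..<T} \<times> frontier \<Omega> \<in> ?S"
    by (intro in_S borel_Times) (auto simp: Keq frontier_def)
  have null: "zero_restriction K \<mu> ({0} \<times> closure \<Omega>)" "zero_restriction K \<mu> ({0<..<T} \<times> frontier \<Omega>)"
    using adj by (auto simp: adjoint_equation_def Let_def K_def)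
  have KS: "K \<in> ?S" using borel_compact[OF K] by (rule in_S) simp
  have "K \<subseteq> ?Q \<union> {T} \<times> closure \<Omega> \<union> {0} \<times> closure \<Omega> \<union> {0<..<T} \<times> frontier \<Omega>"
    using \<Omega>(1) by (auto simp: Keq cylinder_def frontier_def interior_open)
  moreover have "?Q \<inter> {T} \<times> closure \<Omega> = {}" by (auto simp: cylinder_def)
  ultimately have split: "radon_integral K \<mu> K w = radon_integral K \<mu> ?Q w + radon_integral K \<mu> ({T} \<times> closure \<Omega>) w"
    if "continuous_on K w" for w
    using radon_integral_split[OF K \<mu> pos that QS TS _ null 0 FS] by blast
  let ?d = "\<lambda>q. v q - u q" and ?f = "\<lambda>q. y q - z q"
  have cont: "continuous_on K u" "continuous_on K v"
    using u v by (auto simp: U_space_def K_def)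
  then have cont_d: "continuous_on K ?d" by (intro continuous_intros)
  have f: "?f \<in> LrLp r p T \<Omega>"
    using LrLp_lin[OF _ _ v(3) u(3), of 1 "-1"] p r by simp
  have "state_equation s T \<Omega> ?d ?f"
    using state_equation_lin[OF \<Omega> p v(3) u(3) v(2) u(2), of 1 "-1"] by simp
  then have "\<xi> ?f = (LINT q|M. (u q - ud q) * ?d q) + radon_integral K \<mu> ?Q ?d + radon_integral K \<mu> ({T} \<times> closure \<Omega>) ?d"
    using adj f cont_d unfolding adjoint_equation_def Let_def state_equation_def K_def M_def by blast
  also have "\<dots> = (LINT q|M. (u q - ud q) * ?d q) + radon_integral K \<mu> K ?d"
    using split[OF cont_d] by simp
  also have "radon_integral K \<mu> K ?d = radon_integral K \<mu> K v"
    using radon_integral_lin[OF K \<mu> pos cont(2,1) KS, of 1 "-1"] compl by simp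
  finally show ?thesis using vi[OF v(4)] by simp
qed

text \<open>
  Superposition and the convexity of the control set make the whole segment towards \<open>(v, y)\<close>
  feasible.
\<close>

lemma solves_regularized_first_order:
  fixes \<Omega> :: "'a::euclidean_space set"
  assumes \<Omega>: "open \<Omega>" "bounded \<Omega>" and p: "2 \<le> p" and r: "2 \<le> r" and \<gamma>: "0 < \<gamma>"
    and Zad: "Zad \<subseteq> LrLp r p T \<Omega>" "convex_fun_set Zad"
    and ud: "ud \<in> lp_space 2 (lebesgue_on (cylinder T \<Omega>))" and m: "m \<in> lp_space 2 (lebesgue_on (cylinder T \<Omega>))"
    and u: "solves_regularized s r p T \<Omega> Zad ud \<alpha> m \<gamma> u z"
    and v: "v \<in> U_space s r p T \<Omega>" "state_equation s T \<Omega> v y" "y \<in> Zad"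
  defines "M \<equiv> lebesgue_on (cylinder T \<Omega>)"
  shows "0 \<le> (LINT q|M. (u q - ud q) * (v q - u q)) + \<alpha> * (LINT q|M. z q * (y q - z q))
    + (LINT q|M. max 0 (m q + \<gamma> * u q) * (v q - u q))"
proof -
  have u': "u \<in> U_space s r p T \<Omega>" "z \<in> LrLp r p T \<Omega>" "state_equation s T \<Omega> u z" "z \<in> Zad"
    and opt: "\<And>w x. w \<in> U_space s r p T \<Omega> \<Longrightarrow> x \<in> LrLp r p T \<Omega> \<Longrightarrow> state_equation s T \<Omega> w x \<Longrightarrow> x \<in> Zad \<Longrightarrow>
      cost_reg T \<Omega> ud \<alpha> m \<gamma> u z \<le> cost_reg T \<Omega> ud \<alpha> m \<gamma> w x"
    using u by (auto simp: solves_regularized_def is_arg_min_def not_less)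
  have y: "y \<in> LrLp r p T \<Omega>" using v(3) Zad(1) by (rule subsetD[rotated])
  have cont: "continuous_on (closure (cylinder T \<Omega>)) u" "continuous_on (closure (cylinder T \<Omega>)) v"
    using u' v by (auto simp: U_space_def)
  have L2: "u \<in> lp_space 2 M" "v \<in> lp_space 2 M" "z \<in> lp_space 2 M" "y \<in> lp_space 2 M"
    unfolding M_def
    by (rule continuous_on_closure_cylinder_L2[OF \<Omega>] LrLp_subset_L2[OF \<Omega> p r], fact)+
  then have diff: "(\<lambda>q. v q - u q) \<in> lp_space 2 M" "(\<lambda>q. y q - z q) \<in> lp_space 2 M"
    using lp_space_lin[of 2 v M u 1 "-1"] lp_space_lin[of 2 y M z 1 "-1"] by auto
  show ?thesis
    unfolding M_def
  proof (rule regularized_variational_inequality)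
    fix \<tau> :: real assume \<tau>: "0 < \<tau>" "\<tau> \<le> 1"
    let ?w = "\<lambda>q. u q + \<tau> * (v q - u q)" and ?x = "\<lambda>q. z q + \<tau> * (y q - z q)"
    have eq: "?w = (\<lambda>q. (1 - \<tau>) * u q + \<tau> * v q)" "?x = (\<lambda>q. (1 - \<tau>) * z q + \<tau> * y q)"
      by (auto simp: algebra_simps)
    have x: "?x \<in> Zad"
      using Zad(2) u'(4) v(3) \<tau> unfolding eq convex_fun_set_def by simp
    moreover have "?x \<in> LrLp r p T \<Omega>" using x Zad(1) by (rule subsetD[rotated])
    moreover have st: "state_equation s T \<Omega> ?w ?x"
      unfolding eq by (rule state_equation_lin[OF \<Omega> p u'(2) y u'(3) v(2)])
    moreover have "continuous_on (closure (cylinder T \<Omega>)) ?w"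
      by (intro continuous_intros cont)
    ultimately show "cost_reg T \<Omega> ud \<alpha> m \<gamma> u z \<le> cost_reg T \<Omega> ud \<alpha> m \<gamma> ?w ?x"
      by (intro opt) (auto simp: U_space_def state_equation_def)
  qed (use L2 diff ud m \<gamma> in \<open>auto simp: M_def\<close>)
qed

theorem theorem5p2:
  fixes \<Omega> :: "'a::euclidean_space set"
    and s p r T \<alpha> \<gamma> :: real
    and Zad :: "(real \<times> 'a \<Rightarrow> real) set"
    and ud \<mu>h u z u\<gamma> z\<gamma> :: "real \<times> 'a \<Rightarrow> real"
    and \<mu> :: "(real \<times> 'a) set \<Rightarrow> real"
  defines "Q \<equiv> cylinder T \<Omega>"
  assumes \<Omega>: "open \<Omega>" "bounded \<Omega>" "lipschitz_boundary \<Omega>" "exterior_ball_condition \<Omega>"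
    and s: "0 < s" "s < 1"
    and T: "0 < T"
    and pr: "2 \<le> p" "2 \<le> r" "1 > real DIM('a) / (2 * p * s) + 1 / r"
    and Zad: "Zad \<subseteq> LrLp r p T \<Omega>" "Zad \<noteq> {}" "closed_in_LrLp r p T \<Omega> Zad" "convex_fun_set Zad"
    and ud: "ud \<in> lp_space 2 (lebesgue_on Q)"
    and \<alpha>: "\<alpha> > 0"
    and \<gamma>: "\<gamma> > 0"
    and \<mu>h: "\<mu>h \<in> lp_space 2 (lebesgue_on Q)" "AE q in lebesgue_on Q. 0 \<le> \<mu>h q"
    and sol: "solves_constrained s r p T \<Omega> Zad ud \<alpha> u z"
    and multiplier: "lagrange_multiplier s r p T \<Omega> Zad ud \<alpha> u z \<mu>"
    and sol_reg: "solves_regularized s r p T \<Omega> Zad ud \<alpha> \<mu>h \<gamma> u\<gamma> z\<gamma>"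
  shows "\<alpha> * (L2Q_norm T \<Omega> (\<lambda>q. z q - z\<gamma> q))\<^sup>2 + (L2Q_norm T \<Omega> (\<lambda>q. u q - u\<gamma> q))\<^sup>2
           + \<gamma> * (L2Q_norm T \<Omega> (\<lambda>q. max 0 (u\<gamma> q)))\<^sup>2
         \<le> 1 / \<gamma> * (L2Q_norm T \<Omega> \<mu>h)\<^sup>2 + radon_integral (closure Q) \<mu> (closure Q) u\<gamma>
       \<and> L2Q_norm T \<Omega> (\<lambda>q. max 0 (u\<gamma> q))
         \<le> sqrt (2 / \<gamma>) * sqrt (max (1 / \<gamma> * (L2Q_norm T \<Omega> \<mu>h)\<^sup>2)
              (radon_integral (closure Q) \<mu> (closure Q) (\<lambda>q. max 0 (u\<gamma> q))))"
proof -
  let ?M = "lebesgue_on Q" and ?K = "closure Q"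
  note \<Omega>' = \<Omega>(1,2)
  have u: "u \<in> U_space s r p T \<Omega>" "z \<in> LrLp r p T \<Omega>" "state_equation s T \<Omega> u z" "z \<in> Zad"
    and u_le: "\<And>q. q \<in> ?K \<Longrightarrow> u q \<le> 0"
    using sol by (auto simp: solves_constrained_def is_arg_min_def Q_def)
  have v: "u\<gamma> \<in> U_space s r p T \<Omega>" "z\<gamma> \<in> LrLp r p T \<Omega>" "state_equation s T \<Omega> u\<gamma> z\<gamma>" "z\<gamma> \<in> Zad"
    using sol_reg by (auto simp: solves_regularized_def is_arg_min_def)
  have cont: "continuous_on ?K u" "continuous_on ?K u\<gamma>"
    using u v by (auto simp: U_space_def Q_def)
  have L2: "u \<in> lp_space 2 ?M" "u\<gamma> \<in> lp_space 2 ?M" "z \<in> lp_space 2 ?M" "z\<gamma> \<in> lp_space 2 ?M"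
    using cont unfolding Q_def
    by (simp_all add: continuous_on_closure_cylinder_L2[OF \<Omega>'] LrLp_subset_L2[OF \<Omega>' pr(1,2)] u(2) v(2))
  have L2_diff: "(\<lambda>q. f q - g q) \<in> lp_space 2 ?M" if "f \<in> lp_space 2 ?M" "g \<in> lp_space 2 ?M" for f g
    using lp_space_lin[OF _ that, of 1 "-1"] by simp
  have ud': "ud \<in> lp_space 2 ?M" and mh': "\<mu>h \<in> lp_space 2 ?M" by fact+
  define \<rho> where "\<rho> = radon_integral ?K \<mu> ?K"

  have adjoint: "0 \<le> (LINT q|?M. (u q - ud q) * (u\<gamma> q - u q)) + \<alpha> * (LINT q|?M. z q * (z\<gamma> q - z q)) + \<rho> u\<gamma>"
    using multiplier_inequality[OF \<Omega>' T pr(1,2) u(1,3,2) v(1,3,2,4) multiplier]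
    by (simp add: Q_def \<rho>_def)
  have regularized: "0 \<le> (LINT q|?M. (u\<gamma> q - ud q) * (u q - u\<gamma> q)) + \<alpha> * (LINT q|?M. z\<gamma> q * (z q - z\<gamma> q))
      + (LINT q|?M. max 0 (\<mu>h q + \<gamma> * u\<gamma> q) * (u q - u\<gamma> q))"
    using solves_regularized_first_order[OF \<Omega>' pr(1,2) \<gamma> Zad(1,4) _ _ sol_reg u(1,3,4)] ud mh'
    by (simp add: Q_def)

  \<comment> \<open>In the sum of the two inequalities the desired state cancels.\<close>
  have sum_state: "(LINT q|?M. (u q - ud q) * (u\<gamma> q - u q)) + (LINT q|?M. (u\<gamma> q - ud q) * (u q - u\<gamma> q))
      = - (LINT q|?M. (u q - u\<gamma> q)\<^sup>2)"
  proof -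
    have "(LINT q|?M. (u q - ud q) * (u\<gamma> q - u q)) + (LINT q|?M. (u\<gamma> q - ud q) * (u q - u\<gamma> q))
        = (LINT q|?M. (u q - ud q) * (u\<gamma> q - u q) + (u\<gamma> q - ud q) * (u q - u\<gamma> q))"
      by (intro Bochner_Integration.integral_add[symmetric] integrable_mult_L2 L2_diff L2 ud')
    also have "\<dots> = (LINT q|?M. - (u q - u\<gamma> q)\<^sup>2)"
      by (intro Bochner_Integration.integral_cong) (auto simp: power2_eq_square algebra_simps)
    finally show ?thesis by simp
  qed
  have sum_control: "(LINT q|?M. z q * (z\<gamma> q - z q)) + (LINT q|?M. z\<gamma> q * (z q - z\<gamma> q))
      = - (LINT q|?M. (z q - z\<gamma> q)\<^sup>2)"
  proof -
    have "(LINT q|?M. z q * (z\<gamma> q - z q)) + (LINT q|?M. z\<gamma> q * (z q - z\<gamma> q))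
        = (LINT q|?M. z q * (z\<gamma> q - z q) + z\<gamma> q * (z q - z\<gamma> q))"
      by (intro Bochner_Integration.integral_add[symmetric] integrable_mult_L2 L2_diff L2)
    also have "\<dots> = (LINT q|?M. - (z q - z\<gamma> q)\<^sup>2)"
      by (intro Bochner_Integration.integral_cong) (auto simp: power2_eq_square algebra_simps)
    finally show ?thesis by simp
  qed
  have penalty: "(LINT q|?M. max 0 (\<mu>h q + \<gamma> * u\<gamma> q) * (u q - u\<gamma> q))
      \<le> 1 / \<gamma> * (LINT q|?M. (\<mu>h q)\<^sup>2) - \<gamma> * (LINT q|?M. (max 0 (u\<gamma> q))\<^sup>2)"
  proof -
    have sq: "integrable ?M (\<lambda>q. (\<mu>h q)\<^sup>2)" "integrable ?M (\<lambda>q. (max 0 (u\<gamma> q))\<^sup>2)"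
      using mh' lp_space_2_max0[OF L2(2)] by (auto simp: lp_space_2_iff)
    have "(\<lambda>q. \<mu>h q + \<gamma> * u\<gamma> q) \<in> lp_space 2 ?M"
      using lp_space_lin[OF _ mh' L2(2), of 1 \<gamma>] by simp
    then have "(LINT q|?M. max 0 (\<mu>h q + \<gamma> * u\<gamma> q) * (u q - u\<gamma> q))
        \<le> (LINT q|?M. 1 / \<gamma> * (\<mu>h q)\<^sup>2 - \<gamma> * (max 0 (u\<gamma> q))\<^sup>2)"
    proof (intro integral_mono_AE integrable_mult_L2 lp_space_2_max0 L2_diff L2)
      show "integrable ?M (\<lambda>q. 1 / \<gamma> * (\<mu>h q)\<^sup>2 - \<gamma> * (max 0 (u\<gamma> q))\<^sup>2)"
        using sq by auto
      show "AE q in ?M. max 0 (\<mu>h q + \<gamma> * u\<gamma> q) * (u q - u\<gamma> q) \<le> 1 / \<gamma> * (\<mu>h q)\<^sup>2 - \<gamma> * (max 0 (u\<gamma> q))\<^sup>2"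
        using \<mu>h(2) AE_space
      proof eventually_elim
        case (elim q)
        then have "q \<in> Q" by simp
        then have "u q \<le> 0" by (intro u_le subsetD[OF closure_subset])
        with \<gamma> elim(1) show ?case by (rule penalty_pointwise)
      qed
    qed
    then show ?thesis using sq by simp
  qed
  have main: "\<alpha> * (L2Q_norm T \<Omega> (\<lambda>q. z q - z\<gamma> q))\<^sup>2 + (L2Q_norm T \<Omega> (\<lambda>q. u q - u\<gamma> q))\<^sup>2
      + \<gamma> * (L2Q_norm T \<Omega> (\<lambda>q. max 0 (u\<gamma> q)))\<^sup>2
      \<le> 1 / \<gamma> * (L2Q_norm T \<Omega> \<mu>h)\<^sup>2 + \<rho> u\<gamma>"
    using adjoint regularized penalty sum_state arg_cong[OF sum_control, of "\<lambda>x. \<alpha> * x"]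
    unfolding L2Q_norm_power2 Q_def[symmetric] by (simp add: distrib_left)

  let ?n = "L2Q_norm T \<Omega> (\<lambda>q. max 0 (u\<gamma> q))" and ?A = "1 / \<gamma> * (L2Q_norm T \<Omega> \<mu>h)\<^sup>2"
    and ?B = "\<rho> (\<lambda>q. max 0 (u\<gamma> q))"
  have "\<rho> u\<gamma> \<le> ?B"
  proof -
    have "bounded Q" using \<Omega>' by (auto simp: Q_def cylinder_def intro: bounded_Times)
    then have K: "compact ?K" by simp
    have \<mu>: "\<mu> \<in> radon_measures ?K" "\<forall>B\<in>sets (restrict_space borel ?K). 0 \<le> \<mu> B"
      using multiplier by (auto simp: lagrange_multiplier_def Let_def Q_def)
    have "?K \<in> sets (restrict_space borel ?K)"
      using sets.top[of "restrict_space borel ?K"] by (simp add: space_restrict_space)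
    then show ?thesis
      unfolding \<rho>_def using cont(2)
      by (intro radon_integral_mono[OF K \<mu>]) (auto intro: continuous_intros)
  qed
  moreover have "0 \<le> \<alpha> * (L2Q_norm T \<Omega> (\<lambda>q. z q - z\<gamma> q))\<^sup>2" using \<alpha> by simp
  moreover have "0 \<le> (L2Q_norm T \<Omega> (\<lambda>q. u q - u\<gamma> q))\<^sup>2" by simp
  ultimately have "\<gamma> * ?n\<^sup>2 \<le> ?A + ?B" using main by linarith
  \<comment> \<open>The source of the factor 2 under the root.\<close>
  also have "\<dots> \<le> 2 * max ?A ?B" by simp
  finally have "?n\<^sup>2 \<le> 2 / \<gamma> * max ?A ?B" using \<gamma> by (simp add: pos_le_divide_eq mult.commute)
  then have "?n \<le> sqrt (2 / \<gamma> * max ?A ?B)" by (rule real_le_rsqrt)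
  then show ?thesis using main unfolding real_sqrt_mult \<rho>_def by (rule conjI[rotated])
qed

end
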